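(* Let $N$ be a positive integer and let $\rho_{(1)}(x)$ be the eigenvalue density of the Gaussian orthogonal ensemble (see context). Then $\rho_{(1)}$ satisfies on $\mathbb{R}$ the fifth order linear homogeneous differential equation $$-4\rho_{(1)}^{(V)}+5(x^2-4N+2)\rho_{(1)}'''-6x\rho_{(1)}''+\left[-x^4+(8N-4)x^2-16N^2+16N+2\right]\rho_{(1)}'+x(x^2-4N+2)\rho_{(1)}=0.$$
   Context: Consider the probability law on $(\lambda_1,\dots,\lambda_N)\in\mathbb{R}^N$ with density proportional to $\prod_{l=1}^Ne^{-\lambda_l^2/4}\prod_{1\le j<k\le N}|\lambda_k-\lambda_j|$ (GOE, $\beta=1$). The eigenvalue density $\rho_{(1)}$ is the function such that $\int_a^b\rho_{(1)}(x)\,dx$ is the expected number of $\lambda_j$ in $[a,b]$; in particular $\int_{-\infty}^\infty\rho_{(1)}(x)\,dx=N$. *)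

theory Defs
  imports "HOL-Analysis.Analysis"
begin

text \<open>
  Vectors in $R^N$ are functions on \<open>nat\<close> whose coordinates are indexed by \<open>{..<N}\<close>
  (indices shifted by one), with product Lebesgue measure \<open>Pi\<^sub>M {..<N} (\<lambda>_. lborel)\<close>.
\<close>

definition goe_weight :: "nat \<Rightarrow> (nat \<Rightarrow> real) \<Rightarrow> real" where
  "goe_weight N l = (\<Prod>j<N. exp (- ((l j)\<^sup>2 / 4))) * (\<Prod>k<N. \<Prod>j<k. \<bar>l k - l j\<bar>)"

definition goe_partition :: "nat \<Rightarrow> real" where
  "goe_partition N = (\<integral>l. goe_weight N l \<partial>(Pi\<^sub>M {..<N} (\<lambda>_. lborel)))"

definition goe_law :: "nat \<Rightarrow> (nat \<Rightarrow> real) measure" where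
  "goe_law N =
     density (Pi\<^sub>M {..<N} (\<lambda>_. lborel)) (\<lambda>l. ennreal (goe_weight N l / goe_partition N))"

definition goe_expected_count :: "nat \<Rightarrow> real \<Rightarrow> real \<Rightarrow> real" where
  "goe_expected_count N a b = (\<integral>l. real (card {j. j < N \<and> l j \<in> {a..b}}) \<partial>(goe_law N))"

text \<open>
  The integrals over intervals determine a density only up to null sets; continuity singles out
  the representative for which a pointwise differential equation is meaningful.
\<close>

definition is_goe_eigenvalue_density :: "nat \<Rightarrow> (real \<Rightarrow> real) \<Rightarrow> bool" where
  "is_goe_eigenvalue_density N \<rho> \<longleftrightarrow>
     continuous_on UNIV \<rho> \<and>
     (\<forall>a b. a \<le> b \<longrightarrow> (\<rho> has_integral goe_expected_count N a b) {a..b})"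

definition goe_eigenvalue_density :: "nat \<Rightarrow> real \<Rightarrow> real" where
  "goe_eigenvalue_density N = (THE \<rho>. is_goe_eigenvalue_density N \<rho>)"

end

theory Submission
  imports Defs "HOL-Probability.Distributions" "HOL-Real_Asymp.Real_Asymp"
begin

text \<open>
  Idea. Write $\psi_k = He_k(x) e^{-x^2/4}$. The absolute value in the weight is removed by a
  partial fraction identity for signs: for distinct $\lambda_i \ne x$, the product
  $\prod_i sgn(\lambda_i - x)$ is the sum over $i$ of
  $sgn(\lambda_i - x) \prod_{k \ne i} sgn(\lambda_k - \lambda_i)$, plus 1 if the number of points is even.
  Hence the density is a combination of the average characteristic polynomial of $N-1$ eigenvalues
  (for odd $N$) and of $\int |y - x| e^{-(x^2+y^2)/4} F(x,y) dy$, where $F$ is the average of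
  $\prod_l (\lambda_l - x)(\lambda_l - y)$ over $n = N-2$ eigenvalues. Integration by parts in the
  $\lambda_l$ gives the dual equation
  $(x-y)(F_{xx} - x F_x + n F) + 2(F_x - F_y) = 0$. Expanded in Hermite polynomials its symmetric
  solutions are the multiples of $\sum_j (n+1-j) He_j(x) He_j(y) / j!$.
  So the density is a combination of $\psi_{N-1}$ and
  $4 (N \psi_{N-1}^2 - x \psi_{N-1} \psi_N + \psi_N^2) - \psi_{N-1} \epsilon_N$ with
  $\epsilon_N' = -2 \psi_N$. The products of $\psi_{N-1}, \psi_N$ with $\psi_{N-1}, \psi_N, \epsilon_N$ span
  a five-dimensional module closed under differentiation, in which the equation is an identity of
  coefficients. No normalisation constant is needed, since the equation is linear and homogeneous.
\<close>

section \<open>Hermite polynomials and the dual equation\<close>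

text \<open>Probabilists' Hermite polynomials: monic and orthogonal for exp(-x^2/2), the square of
  the one-particle factor exp(-x^2/4).\<close>

fun hermite :: "nat \<Rightarrow> real poly" where
  "hermite 0 = 1"
| "hermite (Suc 0) = [:0, 1:]"
| "hermite (Suc (Suc k)) = [:0, 1:] * hermite (Suc k) - smult (real (Suc k)) (hermite k)"

definition He :: "nat \<Rightarrow> real \<Rightarrow> real" where
  "He k x = poly (hermite k) x"

lemma He_0 [simp]: "He 0 x = 1"
  by (simp add: He_def)

text \<open>At \<open>k = 0\<close> the truncated \<open>k - 1\<close> is harmless, because its term
  carries the factor 0. Later formulas with \<open>k - 1\<close> rely on the same
  convention.\<close>

lemma He_Suc: "He (Suc k) x = x * He k x - real k * He (k - 1) x"
  by (cases k) (simp_all add: He_def)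

lemma degree_hermite: "degree (hermite k) = k \<and> coeff (hermite k) k = 1"
proof (induction k rule: hermite.induct)
  case (3 k)
  have "degree (hermite k) < Suc k" "degree (smult (real (Suc k)) (hermite k)) \<le> k"
    using 3 by auto
  moreover have "degree (pCons 0 (hermite (Suc k))) = Suc (Suc k)"
    using 3 by (metis coeff_pCons_Suc degree_pCons_eq_if degree_0 nat.distinct(1))
  ultimately have "degree (pCons 0 (hermite (Suc k)) - smult (real (Suc k)) (hermite k)) = Suc (Suc k)"
    using degree_add_eq_left[of "- smult (real (Suc k)) (hermite k)" "pCons 0 (hermite (Suc k))"]
    by simp
  moreover have "coeff (hermite k) (Suc (Suc k)) = 0"
    using 3 by (simp add: coeff_eq_0)
  ultimately show ?case using 3 by simp
qed auto

text \<open>Vanishing on an infinite set makes the polynomial zero, and comparing leading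
  coefficients removes the \<open>c j\<close> from the top down. An arbitrary infinite
  \<open>S\<close> is allowed because the two-variable version has to omit a point.\<close>

lemma He_independent:
  assumes "infinite S" "\<And>x. x \<in> S \<Longrightarrow> (\<Sum>j\<le>n. c j * He j x) = 0" "j \<le> n"
  shows "c j = 0"
proof -
  have "(\<Sum>j\<le>n. smult (c j) (hermite j)) = 0"
  proof (rule ccontr)
    assume "(\<Sum>j\<le>n. smult (c j) (hermite j)) \<noteq> 0"
    from poly_roots_finite[OF this] have "finite {x. (\<Sum>j\<le>n. c j * He j x) = 0}"
      by (simp add: poly_sum He_def)
    moreover have "S \<subseteq> {x. (\<Sum>j\<le>n. c j * He j x) = 0}"
      using assms(2) by auto
    ultimately have "finite S" by (rule finite_subset[rotated])
    with assms(1) show False by simp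
  qed
  then show ?thesis
    using assms(3)
  proof (induction n)
    case 0
    then show ?case by (simp add: smult_eq_0_iff)
  next
    case (Suc n)
    have "coeff (\<Sum>j\<le>n. smult (c j) (hermite j)) (Suc n) = (\<Sum>j\<le>n. 0)"
      unfolding coeff_sum by (rule sum.cong) (auto simp: coeff_eq_0 degree_hermite)
    then have "c (Suc n) = 0"
      using arg_cong[OF Suc.prems(1), of "\<lambda>p. coeff p (Suc n)"] degree_hermite[of "Suc n"]
      by (simp del: hermite.simps)
    with Suc show ?case by (cases "j = Suc n") (simp_all del: hermite.simps)
  qed
qed

text \<open>The diagonal is omitted so that relations obtained by dividing by \<open>x - y\<close>
  qualify; for fixed \<open>y\<close> the remaining \<open>x\<close> are still infinitely
  many.\<close>

lemma He_independent2:
  assumes "\<And>x y. x \<noteq> y \<Longrightarrow> (\<Sum>j\<le>n. \<Sum>k\<le>m. c j k * He j x * He k y) = 0" "j \<le> n" "k \<le> m"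
  shows "c j k = 0"
proof -
  have "(\<Sum>k\<le>m. c j k * He k y) = 0" for y
  proof (rule He_independent[where S = "- {y}" and c = "\<lambda>j. \<Sum>k\<le>m. c j k * He k y"])
    show "infinite (- {y})" by (simp add: infinite_UNIV_char_0)
    show "(\<Sum>j\<le>n. (\<Sum>k\<le>m. c j k * He k y) * He j x) = 0" if "x \<in> - {y}" for x
      using assms(1)[of x y] that by (simp add: sum_distrib_left sum_distrib_right mult_ac)
  qed (use assms in auto)
  then show ?thesis
    by (intro He_independent[where S = UNIV and c = "c j" and n = m])
      (use assms(3) in \<open>auto simp: infinite_UNIV_char_0\<close>)
qed

section \<open>Derivatives of Hermite polynomials and their differential equation\<close>

lemma DERIV_He: "(He k has_real_derivative real k * He (k - 1) x) (at x)"
proof (induction k rule: hermite.induct)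
  case (3 k)
  have "((\<lambda>x. x * He (Suc k) x - real (Suc k) * He k x) has_real_derivative
      He (Suc k) x + x * (real (Suc k) * He k x) - real (Suc k) * (real k * He (k - 1) x)) (at x)"
    using 3 by (auto intro!: derivative_eq_intros simp: algebra_simps)
  moreover have "(\<lambda>x. x * He (Suc k) x - real (Suc k) * He k x) = He (Suc (Suc k))"
    by (simp add: He_Suc fun_eq_iff)
  moreover have "He (Suc k) x + x * (real (Suc k) * He k x) - real (Suc k) * (real k * He (k - 1) x)
      = real (Suc (Suc k)) * He (Suc k) x"
    by (simp add: He_Suc algebra_simps)
  ultimately show ?case by simp
qed (auto simp: He_def[abs_def] intro!: derivative_eq_intros)

lemma DERIV_He' [derivative_intros]:
  "(g has_real_derivative g') (at x within A) \<Longrightarrow>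
    ((\<lambda>x. He k (g x)) has_real_derivative real k * He (k - 1) (g x) * g') (at x within A)"
  by (rule DERIV_chain2[OF DERIV_He])

text \<open>Hermite's equation f'' - x f' = - k f with both derivatives written out. It diagonalises
  the second-order part of the dual equation.\<close>

lemma He_ode: "real k * (real (k - 1) * He (k - 2) x) - x * (real k * He (k - 1) x) = - (real k * He k x)"
  by (cases k rule: hermite.cases) (simp_all add: He_Suc algebra_simps numeral_2_eq_2)

section \<open>Christoffel-Darboux numerators and symmetric solutions of the dual equation\<close>

definition christoffel_num :: "nat \<Rightarrow> real \<Rightarrow> real \<Rightarrow> real" where
  "christoffel_num j x y = He (Suc j) x * He j y - He j x * He (Suc j) y"

text \<open>Apply x He_j = He_(j+1) + j He_(j-1) once in x and once in y, and subtract.\<close>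

lemma diff_times_He_He: "(x - y) * (He j x * He j y) = christoffel_num j x y - real j * christoffel_num (j - 1) x y"
proof (cases j)
  case (Suc i)
  show ?thesis
    unfolding christoffel_num_def Suc by (simp add: He_Suc algebra_simps)
qed (simp add: christoffel_num_def He_Suc)

text \<open>
  Antisymmetrising the equation in $x$ and $y$ leaves $(x-y) \sum_{j,k} (k-j) a_{jk} He_j(x) He_k(y) = 0$,
  so the coefficients are diagonal; the remaining equation is then a two-term recurrence for $a_{jj}$.
\<close>

lemma dual_pde_solution:
  fixes a :: "nat \<Rightarrow> nat \<Rightarrow> real"
  assumes sym: "\<And>j k. a j k = a k j"
    and pde: "\<And>x y. (\<Sum>j\<le>n. \<Sum>k\<le>n. a j k * ((x - y) * real (n - j) * He j x * He k y
        + 2 * (real j * He (j - 1) x * He k y - real k * He j x * He (k - 1) y))) = 0"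
  shows "j \<le> n \<Longrightarrow> k \<le> n \<Longrightarrow> j \<noteq> k \<Longrightarrow> a j k = 0"
    and "j \<le> n \<Longrightarrow> a j j = a 0 0 / real (Suc n) * (real (Suc n - j) / fact j)"
proof -
  have eq0: "(\<Sum>j\<le>n. \<Sum>k\<le>n. (a j k * (real k - real j)) * He j x * He k y) = 0" if "x \<noteq> y" for x y
  proof -
    let ?f = "\<lambda>x y j k. a j k * ((x - y) * real (n - j) * He j x * He k y
        + 2 * (real j * He (j - 1) x * He k y - real k * He j x * He (k - 1) y))"
    have "(\<Sum>j\<le>n. \<Sum>k\<le>n. ?f y x j k) = (\<Sum>k\<le>n. \<Sum>j\<le>n. ?f y x j k)"
      by (rule sum.swap)
    then have "0 = (\<Sum>j\<le>n. \<Sum>k\<le>n. ?f x y j k) + (\<Sum>j\<le>n. \<Sum>k\<le>n. ?f y x k j)"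
      using pde[of x y] pde[of y x] by simp
    also have "\<dots> = (\<Sum>j\<le>n. \<Sum>k\<le>n. (x - y) * ((a j k * (real k - real j)) * He j x * He k y))"
      unfolding sum.distrib[symmetric]
      by (intro sum.cong refl) (use sym in \<open>auto simp: of_nat_diff algebra_simps\<close>)
    also have "\<dots> = (x - y) * (\<Sum>j\<le>n. \<Sum>k\<le>n. (a j k * (real k - real j)) * He j x * He k y)"
      by (simp add: sum_distrib_left)
    finally show ?thesis using that by simp
  qed
  show diag: "a j k = 0" if "j \<le> n" "k \<le> n" "j \<noteq> k" for j k
    using He_independent2[where c = "\<lambda>j k. a j k * (real k - real j)", OF eq0] that by fastforce
  \<comment> \<open>\<open>b j\<close> is the coefficient of \<open>christoffel_num j\<close> after
    the equation, now with diagonal \<open>a\<close>, is rewritten by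
    \<open>diff_times_He_He\<close>; its vanishing is the recurrence for
    \<open>a j j\<close>.\<close>
  define b where "b j = real (n - j) * a j j - real (Suc j) * real (Suc n - j) * a (Suc j) (Suc j)" for j
  have b_sum: "(\<Sum>j<n. b j * christoffel_num j x y) = 0" for x y
  proof -
    let ?g = "\<lambda>j. a j j * ((x - y) * real (n - j) * He j x * He j y
        + 2 * (real j * He (j - 1) x * He j y - real j * He j x * He (j - 1) y))"
    have g: "?g j = real (n - j) * a j j * christoffel_num j x y - real j * (real (n - j) + 2) * a j j * christoffel_num (j - 1) x y" for j
    proof -
      have eq: "real j * (He (j - 1) x * He j y - He j x * He (j - 1) y) = - (real j * christoffel_num (j - 1) x y)"
        by (cases j) (simp_all add: christoffel_num_def algebra_simps)
      have "?g j = real (n - j) * a j j * ((x - y) * (He j x * He j y))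
          + 2 * a j j * (real j * (He (j - 1) x * He j y - He j x * He (j - 1) y))"
        by (simp add: algebra_simps)
      also have "\<dots> = real (n - j) * a j j * (christoffel_num j x y - real j * christoffel_num (j - 1) x y)
          + 2 * a j j * (- (real j * christoffel_num (j - 1) x y))"
        unfolding eq diff_times_He_He ..
      finally show ?thesis by (simp add: algebra_simps)
    qed
    have "0 = (\<Sum>j\<le>n. ?g j)"
      unfolding pde[of x y, symmetric]
    proof (intro sum.cong refl)
      fix j assume "j \<in> {..n}"
      then show "(\<Sum>k\<le>n. a j k * ((x - y) * real (n - j) * He j x * He k y
        + 2 * (real j * He (j - 1) x * He k y - real k * He j x * He (k - 1) y))) = ?g j"
        using diag[of j] by (subst sum.remove[of _ j]) (auto intro!: sum.neutral)
    qed
    also have "\<dots> = (\<Sum>j\<le>n. real (n - j) * a j j * christoffel_num j x y)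
        - (\<Sum>j\<le>n. real j * (real (n - j) + 2) * a j j * christoffel_num (j - 1) x y)"
      unfolding g by (simp add: sum_subtractf)
    also have "(\<Sum>j\<le>n. real (n - j) * a j j * christoffel_num j x y) = (\<Sum>j<n. real (n - j) * a j j * christoffel_num j x y)"
      by (simp add: lessThan_Suc_atMost[symmetric])
    \<comment> \<open>Shift of the index: the term j = 0 carries the factor 0, and n - j + 2 becomes
      n + 1 - j, the factor occurring in \<open>b\<close>.\<close>
    also have "(\<Sum>j\<le>n. real j * (real (n - j) + 2) * a j j * christoffel_num (j - 1) x y)
        = (\<Sum>j<n. real (Suc j) * (real (n - Suc j) + 2) * a (Suc j) (Suc j) * christoffel_num j x y)"
      unfolding lessThan_Suc_atMost[symmetric] sum.lessThan_Suc_shift by simp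
    also have "(\<Sum>j<n. real (n - j) * a j j * christoffel_num j x y) - \<dots> = (\<Sum>j<n. b j * christoffel_num j x y)"
      unfolding sum_subtractf[symmetric]
      by (rule sum.cong) (auto simp: b_def of_nat_diff algebra_simps)
    finally show ?thesis by simp
  qed
  have b0: "b i = 0" if "i < n" for i
  proof -
    \<comment> \<open>\<open>c\<close> places each \<open>b\<close> on the two entries next to the
      diagonal with opposite signs, as \<open>christoffel_num\<close> does, so that independence of
      the products He_j(x) He_k(y) applies.\<close>
    define c where "c j k = (if j = Suc k then b k else 0) - (if k = Suc j then b j else 0)" for j k
    have "(\<Sum>j\<le>n. \<Sum>k\<le>n. c j k * He j x * He k y) = (\<Sum>j<n. b j * christoffel_num j x y)" for x y
    proof -
      have 1: "(\<Sum>j\<le>n. \<Sum>k\<le>n. (if j = Suc k then b k else 0) * He j x * He k y)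
          = (\<Sum>j<n. b j * (He (Suc j) x * He j y))" for x y
      proof -
        have "(\<Sum>j\<le>n. \<Sum>k\<le>n. (if j = Suc k then b k else 0) * He j x * He k y)
            = (\<Sum>j<n. \<Sum>k\<le>n. (if k = j then b k * He (Suc j) x * He k y else 0))"
          unfolding lessThan_Suc_atMost[symmetric] sum.lessThan_Suc_shift
          by (auto intro!: sum.cong)
        also have "\<dots> = (\<Sum>j<n. b j * (He (Suc j) x * He j y))"
          by (intro sum.cong refl) (simp add: sum.delta)
        finally show ?thesis .
      qed
      have "(\<Sum>j\<le>n. \<Sum>k\<le>n. c j k * He j x * He k y)
        = (\<Sum>j\<le>n. \<Sum>k\<le>n. (if j = Suc k then b k else 0) * He j x * He k y)
          - (\<Sum>k\<le>n. \<Sum>j\<le>n. (if k = Suc j then b j else 0) * He k y * He j x)"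
        unfolding c_def left_diff_distrib sum_subtractf
        by (subst (2) sum.swap) (simp add: mult_ac)
      also have "\<dots> = (\<Sum>j<n. b j * christoffel_num j x y)"
        unfolding 1 christoffel_num_def by (simp add: sum_subtractf[symmetric] algebra_simps)
      finally show ?thesis .
    qed
    then have "c (Suc i) i = 0"
      using b_sum that by (intro He_independent2[where c = c and n = n and m = n]) auto
    then show ?thesis by (simp add: c_def)
  qed
  show "a j j = a 0 0 / real (Suc n) * (real (Suc n - j) / fact j)" if "j \<le> n" for j
    using that
  proof (induction j)
    case (Suc j)
    then have "real (Suc j) * real (Suc n - j) * a (Suc j) (Suc j) = real (n - j) * a j j"
      using b0[of j] by (simp add: b_def)
    moreover have "a j j = a 0 0 / real (Suc n) * (real (Suc n - j) / fact j)"
      using Suc by simp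
    moreover define r where "r = real (Suc n - j)"
    moreover have "r \<noteq> 0" using Suc by (simp add: r_def)
    ultimately have "real (Suc j) * a (Suc j) (Suc j) = a 0 0 / real (Suc n) * (real (n - j) / fact j)"
      by (simp add: field_simps del: of_nat_diff of_nat_Suc)
    then have "a (Suc j) (Suc j) = a 0 0 / real (Suc n) * (real (n - j) / fact j) / real (Suc j)"
      by (metis nonzero_mult_div_cancel_left of_nat_neq_0)
    then show ?case by (simp add: mult.commute del: of_nat_diff of_nat_Suc)
  qed simp
qed

text \<open>The weights are multiplicities: adding the Christoffel-Darboux formulas truncated at m =
  0, ..., n uses the term j exactly n + 1 - j times. Each induction step adds one
  truncation.\<close>

lemma weighted_CD_sum:
  "(x - y) * (\<Sum>j\<le>n. real (Suc n - j) / fact j * He j x * He j y) = (\<Sum>j\<le>n. christoffel_num j x y / fact j)"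
proof (induction n)
  case (Suc n)
  have CD: "(x - y) * (\<Sum>j\<le>m. He j x * He j y / fact j) = christoffel_num m x y / fact m" for m
  proof (induction m)
    case 0
    show ?case by (simp add: christoffel_num_def He_Suc)
  next
    case (Suc m)
    have "(x - y) * (\<Sum>j\<le>Suc m. He j x * He j y / fact j)
        = (x - y) * (\<Sum>j\<le>m. He j x * He j y / fact j) + (x - y) * (He (Suc m) x * He (Suc m) y) / fact (Suc m)"
      by (simp add: distrib_left)
    also have "\<dots> = christoffel_num m x y / fact m + (christoffel_num (Suc m) x y - real (Suc m) * christoffel_num m x y) / fact (Suc m)"
      unfolding Suc diff_times_He_He by simp
    also have "\<dots> = christoffel_num (Suc m) x y / fact (Suc m)"
      by (simp add: diff_divide_distrib del: of_nat_Suc)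
    finally show ?case .
  qed
  have "(\<Sum>j\<le>Suc n. real (Suc (Suc n) - j) / fact j * He j x * He j y)
      = (\<Sum>j\<le>n. real (Suc n - j) / fact j * He j x * He j y) + (\<Sum>j\<le>Suc n. He j x * He j y / fact j)"
    by (simp add: sum.distrib[symmetric] Suc_diff_le add_divide_distrib distrib_right add.commute mult.assoc)
  then show ?case
    using Suc.IH CD[of "Suc n"] by (simp add: distrib_left)
qed (simp add: christoffel_num_def He_Suc)

section \<open>Integrals on the line and over product measures\<close>

text \<open>Fubini with the new coordinate as the outer variable. In this order the inner integral
  is a function of one eigenvalue position, hence a density.\<close>

lemma (in product_sigma_finite) product_integral_insert_rev:
  fixes f :: "_ \<Rightarrow> _::{banach, second_countable_topology}"
  assumes I: "finite I" "i \<notin> I"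
    and f: "integrable (Pi\<^sub>M (insert i I) M) f"
  shows "integral\<^sup>L (Pi\<^sub>M (insert i I) M) f = (\<integral>x. (\<integral>y. f (y(i:=x)) \<partial>Pi\<^sub>M I M) \<partial>M i)"
proof -
  interpret I: finite_product_sigma_finite M I
    by standard fact
  have "integral\<^sup>L (Pi\<^sub>M (insert i I) M) f = integral\<^sup>L (Pi\<^sub>M ({i} \<union> I) M) f"
    by simp
  also have "\<dots> = (\<integral>x. (\<integral>y. f (merge {i} I (x, y)) \<partial>Pi\<^sub>M I M) \<partial>Pi\<^sub>M {i} M)"
    using f I by (intro product_integral_fold) auto
  also have "\<dots> = (\<integral>x. (\<integral>y. f (y(i := x i)) \<partial>Pi\<^sub>M I M) \<partial>Pi\<^sub>M {i} M)"
  proof (intro Bochner_Integration.integral_cong refl)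
    fix x y assume "y \<in> space (Pi\<^sub>M I M)"
    then have "merge {i} I (x, y) = y(i := x i)"
      using I by (auto simp: merge_def space_PiM PiE_def extensional_def fun_eq_iff)
    then show "f (merge {i} I (x, y)) = f (y(i := x i))" by simp
  qed
  also have "\<dots> = (\<integral>x. (\<integral>y. f (y(i:=x)) \<partial>Pi\<^sub>M I M) \<partial>M i)"
  proof (rule product_integral_singleton)
    have "(\<lambda>(x, y). f (y(i := x))) \<in> borel_measurable (M i \<Otimes>\<^sub>M Pi\<^sub>M I M)"
      using borel_measurable_integrable[OF f] by measurable
    then show "(\<lambda>x. \<integral>y. f (y(i := x)) \<partial>Pi\<^sub>M I M) \<in> borel_measurable (M i)"
      by (rule I.borel_measurable_lebesgue_integral)
  qed
  finally show ?thesis .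
qed

text \<open>The exceptional set \<open>S\<close> makes room for the kinks of absolute values.
  Dominated convergence leads from the intervals [-n, n] to the whole line.\<close>

lemma integral_deriv_real_line:
  fixes g g' :: "real \<Rightarrow> real"
  assumes fin: "finite S" and cont: "continuous_on UNIV g"
    and deriv: "\<And>t. t \<notin> S \<Longrightarrow> (g has_real_derivative g' t) (at t)"
    and int: "integrable lborel g'"
    and top: "(g \<longlongrightarrow> B) at_top" and bot: "(g \<longlongrightarrow> A) at_bot"
  shows "integral\<^sup>L lborel g' = B - A"
proof (rule LIMSEQ_unique)
  have "(\<lambda>n. \<integral>t. indicator {- real n..real n} t * g' t \<partial>lborel) \<longlonglongrightarrow> integral\<^sup>L lborel g'"
  proof (rule integral_dominated_convergence[where w = "\<lambda>t. \<bar>g' t\<bar>"])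
    show "AE t in lborel. (\<lambda>n. indicator {- real n..real n} t * g' t) \<longlonglongrightarrow> g' t"
    proof (intro AE_I2 tendsto_eventually)
      fix t
      obtain m :: nat where "\<bar>t\<bar> \<le> real m" using real_arch_simple by blast
      then show "\<forall>\<^sub>F n in sequentially. indicator {- real n..real n} t * g' t = g' t"
        by (intro eventually_sequentiallyI[of m]) (auto simp: indicator_def abs_le_iff)
    qed
  qed (use int in \<open>auto simp: indicator_def\<close>)
  moreover have "(\<integral>t. indicator {- real n..real n} t * g' t \<partial>lborel) = g (real n) - g (- real n)" for n
  proof -
    have "(g' has_integral g (real n) - g (- real n)) {- real n..real n}"
      by (rule fundamental_theorem_of_calculus_strong[OF fin])
        (use deriv cont in \<open>auto simp: has_real_derivative_iff_has_vector_derivative[symmetric]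
          intro: continuous_on_subset\<close>)
    moreover have "set_integrable lborel {- real n..real n} g'"
      unfolding set_integrable_def by (rule integrable_mult_indicator[OF _ int]) simp
    note set_borel_integral_eq_integral(2)[OF this]
    ultimately show ?thesis
      by (simp add: integral_unique set_lebesgue_integral_def)
  qed
  ultimately show "(\<lambda>n. g (real n) - g (- real n)) \<longlonglongrightarrow> integral\<^sup>L lborel g'"
    by simp
  have "(\<lambda>n. g (real n)) \<longlonglongrightarrow> B"
    by (rule filterlim_compose[OF top filterlim_real_sequentially])
  moreover have "(\<lambda>n. g (- real n)) \<longlonglongrightarrow> A"
    by (intro filterlim_compose[OF bot] filterlim_uminus_at_bot_at_top[THEN filterlim_compose] filterlim_real_sequentially)
  ultimately show "(\<lambda>n. g (real n) - g (- real n)) \<longlonglongrightarrow> B - A"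
    by (rule tendsto_diff)
qed

section \<open>Domination by Gaussians with polynomial factors\<close>

definition gauss :: "real \<Rightarrow> real" where
  "gauss t = exp (- (t\<^sup>2 / 4))"

lemma gauss_pos: "gauss t > 0"
  by (simp add: gauss_def)

lemma gauss_measurable [measurable]: "gauss \<in> borel_measurable borel"
  unfolding gauss_def by measurable

lemma DERIV_gauss [derivative_intros]:
  "(g has_real_derivative g') (at x within A) \<Longrightarrow>
    ((\<lambda>x. gauss (g x)) has_real_derivative - (g x / 2) * gauss (g x) * g') (at x within A)"
  unfolding gauss_def by (auto intro!: derivative_eq_intros)

text \<open>\<open>gauss\<close> is a multiple of the normal density of variance 2, whose absolute
  moments are finite; the power is expanded binomially.\<close>

lemma integrable_power_gauss: "integrable lborel (\<lambda>t. (1 + \<bar>t\<bar>) ^ m * gauss t)"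
proof -
  have eq: "gauss t = sqrt (4 * pi) * normal_density 0 (sqrt 2) t" for t
    by (simp add: gauss_def normal_density_def)
  have mom: "integrable lborel (\<lambda>t. \<bar>t\<bar> ^ k * gauss t)" for k
    using integrable_mult_right[OF integrable_normal_moment_abs[of "sqrt 2" 0 k], of "sqrt (4 * pi)"]
    by (simp add: eq mult_ac)
  show ?thesis
    unfolding binomial_ring sum_distrib_right
    by (intro Bochner_Integration.integrable_sum) (use mom in \<open>simp add: mult.assoc\<close>)
qed

lemma integrable_dominated_gauss:
  assumes "f \<in> borel_measurable borel" "\<And>t. \<bar>f t\<bar> \<le> C * (1 + \<bar>t\<bar>) ^ m * gauss t"
  shows "integrable lborel f"
proof (rule Bochner_Integration.integrable_bound)
  show "integrable lborel (\<lambda>t. C * ((1 + \<bar>t\<bar>) ^ m * gauss t))"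
    by (intro integrable_mult_right integrable_power_gauss)
  show "AE t in lborel. norm (f t) \<le> norm (C * ((1 + \<bar>t\<bar>) ^ m * gauss t))"
    using assms(2) by (auto intro!: AE_I2 simp: mult.assoc intro: order_trans[OF _ abs_ge_self])
qed (use assms in auto)

lemma dominated_gauss_tendsto_0:
  assumes "\<And>t. \<bar>f t\<bar> \<le> C * (1 + \<bar>t\<bar>) ^ m * gauss t"
  shows "(f \<longlongrightarrow> 0) at_top" "(f \<longlongrightarrow> 0) at_bot"
proof -
  have lim: "((\<lambda>t. C * (1 + \<bar>t\<bar>) ^ m * gauss t) \<longlongrightarrow> 0) at_top"
    unfolding gauss_def by real_asymp
  then show "(f \<longlongrightarrow> 0) at_top"
    by (rule Lim_null_comparison[rotated]) (use assms in auto)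
  have "((\<lambda>t. C * (1 + \<bar>t\<bar>) ^ m * gauss t) \<longlongrightarrow> 0) at_bot"
    unfolding filterlim_at_bot_mirror using lim by (simp add: gauss_def)
  then show "(f \<longlongrightarrow> 0) at_bot"
    by (rule Lim_null_comparison[rotated]) (use assms in auto)
qed

section \<open>The Vandermonde weight and integration by parts\<close>

abbreviation lborel_PiM :: "nat set \<Rightarrow> (nat \<Rightarrow> real) measure" where
  "lborel_PiM I \<equiv> Pi\<^sub>M I (\<lambda>_. lborel)"

interpretation lborel_PiM: product_sigma_finite "\<lambda>_::nat. lborel :: real measure"
  by standard

text \<open>The bound is a power of a product over the coordinates, not of a norm, so that together
  with the Gaussian factors it splits into one-variable integrals.\<close>

definition poly_growth :: "nat set \<Rightarrow> ((nat \<Rightarrow> real) \<Rightarrow> real) \<Rightarrow> bool" where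
  "poly_growth I f \<longleftrightarrow> f \<in> borel_measurable (lborel_PiM I) \<and>
     (\<exists>C m. \<forall>l. \<bar>f l\<bar> \<le> C * (\<Prod>i\<in>I. 1 + \<bar>l i\<bar>) ^ m)"

lemma one_le_prod_one_plus_abs: "1 \<le> (\<Prod>i\<in>I. 1 + \<bar>l i :: real\<bar>)"
  by (rule prod_ge_1) auto

lemma poly_growth_dominated:
  assumes "poly_growth I g" "f \<in> borel_measurable (lborel_PiM I)" "\<And>l. \<bar>f l\<bar> \<le> \<bar>g l\<bar>"
  shows "poly_growth I f"
  using assms unfolding poly_growth_def by (meson order_trans)

lemma poly_growth_const: "poly_growth I (\<lambda>l. c)"
  unfolding poly_growth_def by (intro conjI exI[of _ "\<bar>c\<bar>"] exI[of _ 0]) auto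

lemma poly_growth_coord:
  assumes "finite I" "i \<in> I"
  shows "poly_growth I (\<lambda>l. l i)"
proof -
  have "\<bar>l i\<bar> \<le> 1 * (\<Prod>i\<in>I. 1 + \<bar>l i\<bar>) ^ 1" for l :: "nat \<Rightarrow> real"
  proof -
    have "(\<Prod>i\<in>I. 1 + \<bar>l i\<bar>) = (1 + \<bar>l i\<bar>) * (\<Prod>i\<in>I - {i}. 1 + \<bar>l i\<bar>)"
      using assms by (simp add: prod.remove)
    moreover have "(1 + \<bar>l i\<bar>) * 1 \<le> (1 + \<bar>l i\<bar>) * (\<Prod>i\<in>I - {i}. 1 + \<bar>l i\<bar>)"
      by (intro mult_left_mono one_le_prod_one_plus_abs) auto
    ultimately show ?thesis by simp
  qed
  moreover have "(\<lambda>l. l i) \<in> borel_measurable (lborel_PiM I)"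
    using assms by measurable
  ultimately show ?thesis unfolding poly_growth_def by blast
qed

lemma poly_growth_add:
  assumes "poly_growth I f" "poly_growth I g"
  shows "poly_growth I (\<lambda>l. f l + g l)"
proof -
  obtain C m D k where f: "\<And>l. \<bar>f l\<bar> \<le> C * (\<Prod>i\<in>I. 1 + \<bar>l i\<bar>) ^ m"
    and g: "\<And>l. \<bar>g l\<bar> \<le> D * (\<Prod>i\<in>I. 1 + \<bar>l i\<bar>) ^ k"
    using assms unfolding poly_growth_def by blast
  have "\<bar>f l + g l\<bar> \<le> (\<bar>C\<bar> + \<bar>D\<bar>) * (\<Prod>i\<in>I. 1 + \<bar>l i\<bar>) ^ (m + k)" for l
  proof -
    let ?M = "\<Prod>i\<in>I. 1 + \<bar>l i\<bar>"
    have "?M ^ m \<le> ?M ^ (m + k)" "?M ^ k \<le> ?M ^ (m + k)"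
      using one_le_prod_one_plus_abs by (auto intro!: power_increasing)
    moreover have "\<bar>f l\<bar> \<le> \<bar>C\<bar> * ?M ^ m" "\<bar>g l\<bar> \<le> \<bar>D\<bar> * ?M ^ k"
      using f[of l] g[of l] one_le_prod_one_plus_abs[of l I]
      by (auto elim!: order_trans intro!: mult_right_mono)
    ultimately have "\<bar>f l\<bar> \<le> \<bar>C\<bar> * ?M ^ (m + k)" "\<bar>g l\<bar> \<le> \<bar>D\<bar> * ?M ^ (m + k)"
      by (meson abs_ge_zero mult_left_mono order_trans)+
    then show ?thesis by (simp add: distrib_right)
  qed
  with assms show ?thesis unfolding poly_growth_def by (auto intro!: borel_measurable_add)
qed

lemma poly_growth_mult:
  assumes "poly_growth I f" "poly_growth I g"
  shows "poly_growth I (\<lambda>l. f l * g l)"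
proof -
  obtain C m D k where f: "\<And>l. \<bar>f l\<bar> \<le> C * (\<Prod>i\<in>I. 1 + \<bar>l i\<bar>) ^ m"
    and g: "\<And>l. \<bar>g l\<bar> \<le> D * (\<Prod>i\<in>I. 1 + \<bar>l i\<bar>) ^ k"
    using assms unfolding poly_growth_def by blast
  have "\<bar>f l * g l\<bar> \<le> (C * D) * (\<Prod>i\<in>I. 1 + \<bar>l i\<bar>) ^ (m + k)" for l
    using mult_mono[OF f[of l] g[of l]] order_trans[OF abs_ge_zero f[of l]]
    by (simp add: abs_mult power_add mult_ac)
  with assms show ?thesis unfolding poly_growth_def by (auto intro!: borel_measurable_times)
qed

lemma poly_growth_uminus: "poly_growth I f \<Longrightarrow> poly_growth I (\<lambda>l. - f l)"
  using poly_growth_mult[OF poly_growth_const[of I "-1"], of f] by simp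

lemma poly_growth_diff: "poly_growth I f \<Longrightarrow> poly_growth I g \<Longrightarrow> poly_growth I (\<lambda>l. f l - g l)"
  using poly_growth_add[OF _ poly_growth_uminus, of I f g] by simp

lemma poly_growth_abs: "poly_growth I f \<Longrightarrow> poly_growth I (\<lambda>l. \<bar>f l\<bar>)"
  unfolding poly_growth_def by auto

lemma poly_growth_sum: "(\<And>a. a \<in> A \<Longrightarrow> poly_growth I (f a)) \<Longrightarrow> poly_growth I (\<lambda>l. \<Sum>a\<in>A. f a l)"
  by (induction A rule: infinite_finite_induct) (auto intro: poly_growth_const poly_growth_add)

lemma poly_growth_prod: "(\<And>a. a \<in> A \<Longrightarrow> poly_growth I (f a)) \<Longrightarrow> poly_growth I (\<lambda>l. \<Prod>a\<in>A. f a l)"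
  by (induction A rule: infinite_finite_induct) (auto intro: poly_growth_const poly_growth_mult)

lemmas poly_growth_intros = poly_growth_const poly_growth_coord poly_growth_add poly_growth_diff
  poly_growth_uminus poly_growth_mult poly_growth_abs poly_growth_sum poly_growth_prod

lemma poly_growth_measurable: "poly_growth I f \<Longrightarrow> f \<in> borel_measurable (lborel_PiM I)"
  by (simp add: poly_growth_def)

lemma poly_growth_integrable:
  assumes "finite I" "poly_growth I f"
  shows "integrable (lborel_PiM I) (\<lambda>l. (\<Prod>i\<in>I. gauss (l i)) * f l)"
proof -
  obtain C m where f: "\<And>l. \<bar>f l\<bar> \<le> C * (\<Prod>i\<in>I. 1 + \<bar>l i\<bar>) ^ m"
    using assms unfolding poly_growth_def by blast
  show ?thesis
  proof (rule Bochner_Integration.integrable_bound)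
    show "integrable (lborel_PiM I) (\<lambda>l. C * (\<Prod>i\<in>I. (1 + \<bar>l i\<bar>) ^ m * gauss (l i)))"
      by (intro integrable_mult_right lborel_PiM.product_integrable_prod assms integrable_power_gauss)
    show "(\<lambda>l. (\<Prod>i\<in>I. gauss (l i)) * f l) \<in> borel_measurable (lborel_PiM I)"
      using poly_growth_measurable[OF assms(2)] by measurable
    show "AE l in lborel_PiM I. norm ((\<Prod>i\<in>I. gauss (l i)) * f l)
        \<le> norm (C * (\<Prod>i\<in>I. (1 + \<bar>l i\<bar>) ^ m * gauss (l i)))"
    proof (rule AE_I2)
      fix l :: "nat \<Rightarrow> real"
      have pos: "0 \<le> (\<Prod>i\<in>I. gauss (l i))"
        by (intro prod_nonneg) (simp add: gauss_pos less_imp_le)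
      have "norm ((\<Prod>i\<in>I. gauss (l i)) * f l) \<le> (\<Prod>i\<in>I. gauss (l i)) * (C * (\<Prod>i\<in>I. 1 + \<bar>l i\<bar>) ^ m)"
        using mult_left_mono[OF f[of l] pos] pos by (simp add: abs_mult)
      also have "\<dots> = C * (\<Prod>i\<in>I. (1 + \<bar>l i\<bar>) ^ m * gauss (l i))"
        by (simp add: prod.distrib prod_power_distrib)
      finally show "norm ((\<Prod>i\<in>I. gauss (l i)) * f l) \<le> norm (C * (\<Prod>i\<in>I. (1 + \<bar>l i\<bar>) ^ m * gauss (l i)))"
        by simp
    qed
  qed
qed

section \<open>The absolute Vandermonde product and its logarithmic derivatives\<close>

definition vdm :: "nat set \<Rightarrow> (nat \<Rightarrow> real) \<Rightarrow> real" where
  "vdm I l = (\<Prod>k\<in>I. \<Prod>j\<in>{j \<in> I. j < k}. \<bar>l k - l j\<bar>)"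

lemma vdm_nonneg: "vdm I l \<ge> 0"
  unfolding vdm_def by (intro prod_nonneg ballI) auto

text \<open>Because of the absolute values the place of \<open>i\<close> in the order is irrelevant:
  pairs with smaller and with larger indices merge into one product. Any eigenvalue can thus be
  singled out.\<close>

lemma vdm_insert:
  assumes "finite I" "i \<notin> I"
  shows "vdm (insert i I) l = vdm I l * (\<Prod>k\<in>I. \<bar>l k - l i\<bar>)"
proof -
  have "(\<Prod>j\<in>{j \<in> insert i I. j < k}. \<bar>l k - l j\<bar>)
      = (if i < k then \<bar>l k - l i\<bar> else 1) * (\<Prod>j\<in>{j \<in> I. j < k}. \<bar>l k - l j\<bar>)" for k
  proof (cases "i < k")
    case True
    then have "{j \<in> insert i I. j < k} = insert i {j \<in> I. j < k}" by auto
    with True assms show ?thesis by simp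
  next
    case False
    then have "{j \<in> insert i I. j < k} = {j \<in> I. j < k}" by auto
    with False show ?thesis by simp
  qed
  then have "vdm (insert i I) l = (\<Prod>j\<in>{j \<in> I. j < i}. \<bar>l i - l j\<bar>)
      * ((\<Prod>k\<in>I. if i < k then \<bar>l k - l i\<bar> else 1) * vdm I l)"
    using assms by (simp add: vdm_def prod.distrib)
  also have "(\<Prod>j\<in>{j \<in> I. j < i}. \<bar>l i - l j\<bar>) = (\<Prod>k\<in>I. if k < i then \<bar>l k - l i\<bar> else 1)"
    using assms by (simp add: prod.inter_filter abs_minus_commute)
  also have "\<dots> * ((\<Prod>k\<in>I. if i < k then \<bar>l k - l i\<bar> else 1) * vdm I l)
      = vdm I l * (\<Prod>k\<in>I. (if k < i then \<bar>l k - l i\<bar> else 1) * (if i < k then \<bar>l k - l i\<bar> else 1))"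
    by (simp add: prod.distrib)
  also have "(\<Prod>k\<in>I. (if k < i then \<bar>l k - l i\<bar> else 1) * (if i < k then \<bar>l k - l i\<bar> else 1))
      = (\<Prod>k\<in>I. \<bar>l k - l i\<bar>)"
    using assms by (intro prod.cong refl) auto
  finally show ?thesis .
qed

lemma vdm_remove:
  "finite I \<Longrightarrow> i \<in> I \<Longrightarrow> vdm I l = vdm (I - {i}) l * (\<Prod>k\<in>I - {i}. \<bar>l k - l i\<bar>)"
  using vdm_insert[of "I - {i}" i l] by (simp add: insert_absorb)

lemma vdm_fun_upd: "i \<notin> I \<Longrightarrow> vdm I (l(i := t)) = vdm I l"
  unfolding vdm_def by (intro prod.cong refl) auto

lemma vdm_eq_0:
  assumes "finite I" "i \<in> I" "k \<in> I" "i \<noteq> k" "l i = l k"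
  shows "vdm I l = 0"
  using assms by (auto simp: vdm_remove[of I i])

lemma poly_growth_vdm: "finite I \<Longrightarrow> J \<subseteq> I \<Longrightarrow> poly_growth I (vdm J)"
  unfolding vdm_def[abs_def] by (intro poly_growth_intros) auto

text \<open>The denominator cancels against a factor of \<open>vdm\<close>. What remains of the two
  has absolute value at most 1, also at coincident points, where division by zero gives 0.\<close>

lemma poly_growth_vdm_div:
  assumes "finite I" "i \<in> I" "k \<in> I" "i \<noteq> k"
  shows "poly_growth I (\<lambda>l. vdm I l / (l i - l k))"
proof (rule poly_growth_dominated)
  show "poly_growth I (\<lambda>l. vdm (I - {i}) l * (\<Prod>j\<in>I - {i} - {k}. \<bar>l j - l i\<bar>))"
    using assms by (intro poly_growth_intros poly_growth_vdm) auto
  have "(\<lambda>l. l i) \<in> borel_measurable (lborel_PiM I)" "(\<lambda>l. l k) \<in> borel_measurable (lborel_PiM I)"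
    using assms by measurable
  then show "(\<lambda>l. vdm I l / (l i - l k)) \<in> borel_measurable (lborel_PiM I)"
    using poly_growth_measurable[OF poly_growth_vdm[OF assms(1) order_refl]] by measurable
  fix l :: "nat \<Rightarrow> real"
  have "(\<Prod>j\<in>I - {i}. \<bar>l j - l i\<bar>) = \<bar>l k - l i\<bar> * (\<Prod>j\<in>I - {i} - {k}. \<bar>l j - l i\<bar>)"
    using assms by (intro prod.remove) auto
  then have "vdm I l / (l i - l k)
      = vdm (I - {i}) l * (\<Prod>j\<in>I - {i} - {k}. \<bar>l j - l i\<bar>) * (\<bar>l k - l i\<bar> / (l i - l k))"
    using assms by (simp add: vdm_remove[of I i])
  moreover have "\<bar>\<bar>l k - l i\<bar> / (l i - l k)\<bar> \<le> 1"
    by (simp add: abs_minus_commute)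
  ultimately show "\<bar>vdm I l / (l i - l k)\<bar> \<le> \<bar>vdm (I - {i}) l * (\<Prod>j\<in>I - {i} - {k}. \<bar>l j - l i\<bar>)\<bar>"
    by (metis abs_ge_zero abs_mult mult_left_le)
qed

lemma DERIV_prod_abs_diff:
  assumes "finite J" "t \<notin> l ` J"
  shows "((\<lambda>t. \<Prod>k\<in>J. \<bar>l k - t\<bar>) has_real_derivative
    (\<Prod>k\<in>J. \<bar>l k - t\<bar>) * (\<Sum>k\<in>J. 1 / (t - l k))) (at (t :: real))"
  using assms
proof (induction J)
  case (insert j J)
  have "((\<lambda>t. \<bar>l j - t\<bar>) has_real_derivative \<bar>l j - t\<bar> * (1 / (t - l j))) (at t)"
  proof -
    \<comment> \<open>The absolute value is differentiated as the square root of a square, smooth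
      away from 0.\<close>
    have "((\<lambda>t. (l j - t)\<^sup>2) has_real_derivative 2 * (l j - t) * (0 - 1)) (at t)"
      by (auto intro!: derivative_eq_intros)
    from DERIV_chain2[OF DERIV_real_sqrt this] insert.prems
    have "((\<lambda>t. sqrt ((l j - t)\<^sup>2)) has_real_derivative
        inverse (sqrt ((l j - t)\<^sup>2)) / 2 * (2 * (l j - t) * (0 - 1))) (at t)"
      by simp
    moreover have "inverse (sqrt ((l j - t)\<^sup>2)) / 2 * (2 * (l j - t) * (0 - 1)) = \<bar>l j - t\<bar> * (1 / (t - l j))"
      using insert.prems by (simp add: abs_real_def field_simps)
    ultimately show ?thesis by (simp only: real_sqrt_abs)
  qed
  from DERIV_mult[OF this insert.IH] insert show ?case
    by (simp add: algebra_simps)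
qed simp

lemma abs_diff_le: "\<bar>a - b\<bar> \<le> (1 + \<bar>a\<bar>) * (1 + \<bar>b :: real\<bar>)"
  using abs_triangle_ineq4[of a b] mult_nonneg_nonneg[OF abs_ge_zero abs_ge_zero, of a b]
  unfolding ring_distribs by linarith

text \<open>Away from coincidences, the Gaussians times \<open>F\<close> are the derivative in
  \<open>l i\<close> of (l_i - y) times the weight times \<open>h\<close>, so already the integral
  over \<open>l i\<close> alone vanishes. The factor l_i - y later completes a characteristic
  polynomial at y.\<close>

lemma goe_integration_by_parts:
  fixes y :: real
  assumes fin: "finite I" and i: "i \<in> I" and h: "poly_growth I h" "\<And>l t. h (l(i := t)) = h l"
  defines "F \<equiv> (\<lambda>l. vdm I l * h l * (1 + (l i - y) * ((\<Sum>k\<in>I - {i}. 1 / (l i - l k)) - l i / 2)))"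
  shows "poly_growth I F" and "(\<integral>l. (\<Prod>j\<in>I. gauss (l j)) * F l \<partial>lborel_PiM I) = 0"
proof -
  \<comment> \<open>Expanded so that each 1 / (l_i - l_k) occurs only under \<open>vdm\<close>,
    where \<open>poly_growth_vdm_div\<close> controls it.\<close>
  have "poly_growth I (\<lambda>l. vdm I l * h l + (l i - y) * h l * (\<Sum>k\<in>I - {i}. vdm I l / (l i - l k))
      - (l i - y) * h l * vdm I l * (1 / 2) * l i)"
    using fin i h by (intro poly_growth_intros poly_growth_vdm poly_growth_vdm_div) auto
  also have "(\<lambda>l. vdm I l * h l + (l i - y) * h l * (\<Sum>k\<in>I - {i}. vdm I l / (l i - l k))
      - (l i - y) * h l * vdm I l * (1 / 2) * l i) = F"
  proof
    fix l
    have "(\<Sum>k\<in>I - {i}. vdm I l / (l i - l k)) = vdm I l * (\<Sum>k\<in>I - {i}. 1 / (l i - l k))"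
      by (simp add: sum_distrib_left)
    then show "vdm I l * h l + (l i - y) * h l * (\<Sum>k\<in>I - {i}. vdm I l / (l i - l k))
      - (l i - y) * h l * vdm I l * (1 / 2) * l i = F l"
      unfolding F_def by (simp add: field_simps)
  qed
  finally show F: "poly_growth I F" .
  define J where "J = I - {i}"
  have J: "finite J" "i \<notin> J" "I = insert i J" using fin i by (auto simp: J_def)
  have "(\<integral>t. (\<Prod>j\<in>I. gauss ((l(i := t)) j)) * F (l(i := t)) \<partial>lborel) = 0" for l :: "nat \<Rightarrow> real"
  proof -
    define V where "V t = (\<Prod>k\<in>J. \<bar>l k - t\<bar>)" for t
    define g where "g t = (t - y) * V t * gauss t" for t
    define g' where "g' t = gauss t * (V t * (1 + (t - y) * ((\<Sum>k\<in>J. 1 / (t - l k)) - t / 2)))" for t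
    \<comment> \<open>The integral of a non-integrable function is 0 by convention, so that case is trivial.\<close>
    have "(\<integral>t. g' t \<partial>lborel) = 0"
    proof (cases "integrable lborel g'")
      case True
      have bound: "\<bar>g t\<bar> \<le> (1 + \<bar>y\<bar>) * (\<Prod>k\<in>J. 1 + \<bar>l k\<bar>) * (1 + \<bar>t\<bar>) ^ Suc (card J) * gauss t" for t
      proof -
        have "\<bar>t - y\<bar> \<le> (1 + \<bar>y\<bar>) * (1 + \<bar>t\<bar>)"
          using abs_diff_le[of t y] by (simp add: mult.commute)
        moreover have "V t \<le> (\<Prod>k\<in>J. (1 + \<bar>l k\<bar>) * (1 + \<bar>t\<bar>))"
          unfolding V_def
          by (intro prod_mono conjI abs_ge_zero abs_diff_le)
        moreover have "0 \<le> V t" unfolding V_def by (intro prod_nonneg) auto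
        ultimately have "\<bar>t - y\<bar> * V t \<le> ((1 + \<bar>y\<bar>) * (1 + \<bar>t\<bar>)) * (\<Prod>k\<in>J. (1 + \<bar>l k\<bar>) * (1 + \<bar>t\<bar>))"
          by (intro mult_mono) auto
        from mult_right_mono[OF this less_imp_le[OF gauss_pos[of t]]] \<open>0 \<le> V t\<close> show ?thesis
          unfolding g_def by (simp add: abs_mult prod.distrib mult_ac gauss_pos less_imp_le abs_of_pos)
      qed
      \<comment> \<open>The kinks of \<open>V\<close> lie at the finitely many other points, and the
        Gaussian makes both boundary terms vanish.\<close>
      have "integral\<^sup>L lborel g' = 0 - 0"
      proof (rule integral_deriv_real_line[of "l ` J" g])
        show "continuous_on UNIV g"
          unfolding g_def V_def gauss_def by (intro continuous_intros) auto
        show "(g has_real_derivative g' t) (at t)" if "t \<notin> l ` J" for t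
        proof -
          have "(g has_real_derivative (1 * V t + (t - y) * (V t * (\<Sum>k\<in>J. 1 / (t - l k)))) * gauss t
              + (t - y) * V t * (- (t / 2) * gauss t * 1)) (at t)"
            unfolding g_def V_def
            by (rule derivative_eq_intros DERIV_prod_abs_diff that J(1) refl)+ (simp add: algebra_simps)
          then show ?thesis
            unfolding g'_def by (rule back_subst[of "\<lambda>d. (g has_real_derivative d) (at t)"]) (simp add: field_simps)
        qed
      qed (use J True dominated_gauss_tendsto_0[OF bound] in auto)
      then show ?thesis by simp
    qed (simp add: not_integrable_integral_eq)
    moreover have "(\<Prod>j\<in>I. gauss ((l(i := t)) j)) * F (l(i := t))
        = (\<Prod>j\<in>J. gauss (l j)) * vdm J l * h l * g' t" for t
    proof -
      have "(\<Prod>j\<in>I. gauss ((l(i := t)) j)) = gauss t * (\<Prod>j\<in>J. gauss (l j))"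
        using J by (auto intro!: prod.cong)
      moreover have "vdm I (l(i := t)) = vdm J l * V t"
        using J vdm_insert[of J i "l(i := t)"] by (auto simp: vdm_fun_upd V_def intro!: prod.cong)
      moreover have "(\<Sum>k\<in>I - {i}. 1 / ((l(i := t)) i - (l(i := t)) k)) = (\<Sum>k\<in>J. 1 / (t - l k))"
        unfolding J_def by (rule sum.cong) auto
      ultimately show ?thesis
        unfolding F_def g'_def h(2) by simp
    qed
    ultimately show ?thesis by simp
  qed
  then show "(\<integral>l. (\<Prod>j\<in>I. gauss (l j)) * F l \<partial>lborel_PiM I) = 0"
    using lborel_PiM.product_integral_insert[OF J(1,2), of "\<lambda>l. (\<Prod>j\<in>I. gauss (l j)) * F l"]
      poly_growth_integrable[OF fin F] by (simp add: J(3)[symmetric])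
qed

section \<open>Signs and characteristic polynomials\<close>

text \<open>Induction adding a largest point j. It changes no sign in the old summands, and its own
  summand is sgn(l_j - x) (-1)^(card I). If l_j < x, all old points lie left of x as well, so the
  old product is (-1)^(card I); the change of the parity term balances the rest.\<close>

lemma prod_sgn_diff:
  fixes l :: "'a \<Rightarrow> real"
  assumes "finite I" "inj_on l I" "x \<notin> l ` I"
  shows "(\<Prod>i\<in>I. sgn (l i - x)) =
    of_bool (even (card I)) + (\<Sum>i\<in>I. sgn (l i - x) * (\<Prod>k\<in>I - {i}. sgn (l k - l i)))"
  using assms
proof (induction I rule: finite_ranking_induct[where f = l])
  case (insert j I)
  show ?case
  proof (cases "j \<in> I")
    case True
    then show ?thesis using insert by (simp add: insert_absorb)
  next
    case False
    have less: "l i < l j" if "i \<in> I" for i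
      using that insert.hyps(2)[of i] insert.prems(1) False
      by (metis inj_onD insertCI order_less_le)
    have IH: "(\<Prod>i\<in>I. sgn (l i - x)) =
      of_bool (even (card I)) + (\<Sum>i\<in>I. sgn (l i - x) * (\<Prod>k\<in>I - {i}. sgn (l k - l i)))"
      using insert by auto
    have "(\<Sum>i\<in>I. sgn (l i - x) * (\<Prod>k\<in>insert j I - {i}. sgn (l k - l i)))
        = (\<Sum>i\<in>I. sgn (l i - x) * (\<Prod>k\<in>I - {i}. sgn (l k - l i)))"
    proof (intro sum.cong refl)
      fix i assume "i \<in> I"
      then have "insert j I - {i} = insert j (I - {i})" using False by auto
      then show "sgn (l i - x) * (\<Prod>k\<in>insert j I - {i}. sgn (l k - l i))
          = sgn (l i - x) * (\<Prod>k\<in>I - {i}. sgn (l k - l i))"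
        using less[OF \<open>i \<in> I\<close>] False insert.hyps(1) by simp
    qed
    moreover have "(\<Prod>k\<in>insert j I - {j}. sgn (l k - l j)) = (-1) ^ card I"
    proof -
      have "(\<Prod>k\<in>insert j I - {j}. sgn (l k - l j)) = (\<Prod>k\<in>I. -1)"
        using False less by (intro prod.cong) auto
      then show ?thesis by simp
    qed
    moreover have "(\<Prod>i\<in>I. sgn (l i - x)) = (-1) ^ card I" if "l j < x"
    proof -
      have "(\<Prod>i\<in>I. sgn (l i - x)) = (\<Prod>i\<in>I. -1)"
        using less that by (intro prod.cong) (auto simp: sgn_real_def dest: order_less_trans)
      then show ?thesis by simp
    qed
    moreover have "x \<noteq> l j" using insert.prems by auto
    ultimately show ?thesis
      using IH False insert.hyps(1) by (cases "l j < x") (auto simp: sgn_real_def)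
  qed
qed simp

text \<open>Multiply \<open>prod_sgn_diff\<close> by \<open>vdm\<close> and the product without
  absolute values. In summand i the signs turn the factors |l_k - l_i| of \<open>vdm\<close> into
  l_k - l_i; with y = l_i this is the weight of the other points times the product of (l_k - x)(l_k
  - y).\<close>

lemma vdm_prod_abs_diff:
  assumes "finite I"
  shows "vdm I l * (\<Prod>i\<in>I. \<bar>l i - x\<bar>) = of_bool (even (card I)) * vdm I l * (\<Prod>i\<in>I. l i - x)
    + (\<Sum>i\<in>I. \<bar>l i - x\<bar> * (vdm (I - {i}) l * (\<Prod>k\<in>I - {i}. (l k - x) * (l k - l i))))"
proof (cases "vdm I l = 0 \<or> x \<in> l ` I")
  case True
  have zero: "\<bar>l i - x\<bar> * (vdm (I - {i}) l * (\<Prod>k\<in>I - {i}. (l k - x) * (l k - l i))) = 0" if "i \<in> I" for i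
  proof (cases "vdm I l = 0")
    case True
    then have "vdm (I - {i}) l * (\<Prod>k\<in>I - {i}. \<bar>l k - l i\<bar>) = 0"
      using vdm_remove[OF assms that] by simp
    then have "vdm (I - {i}) l * (\<Prod>k\<in>I - {i}. l k - l i) = 0"
      unfolding abs_prod[symmetric] mult_eq_0_iff abs_eq_0 .
    then have "(vdm (I - {i}) l * (\<Prod>k\<in>I - {i}. l k - l i)) * (\<Prod>k\<in>I - {i}. l k - x) = 0"
      by simp
    then show ?thesis unfolding prod.distrib by (simp only: mult_ac mult_zero_right)
  next
    case False
    then obtain k where "k \<in> I" "x = l k" using True by auto
    then show ?thesis using assms by (cases "k = i") auto
  qed
  have "vdm I l * (\<Prod>i\<in>I. \<bar>l i - x\<bar>) = 0" "vdm I l * (\<Prod>i\<in>I. l i - x) = 0"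
    using True assms by auto
  moreover have "(\<Sum>i\<in>I. \<bar>l i - x\<bar> * (vdm (I - {i}) l * (\<Prod>k\<in>I - {i}. (l k - x) * (l k - l i)))) = 0"
    by (rule sum.neutral) (use zero in blast)
  ultimately show ?thesis by (simp only: mult.assoc mult_zero_right add_0)
next
  case False
  have inj: "inj_on l I"
    using False vdm_eq_0[OF assms] by (auto intro!: inj_onI)
  have "(\<Prod>i\<in>I. \<bar>l i - x\<bar>) = (\<Prod>i\<in>I. l i - x) * (\<Prod>i\<in>I. sgn (l i - x))"
    by (simp add: prod.distrib[symmetric] abs_sgn)
  also have "\<dots> = (\<Prod>i\<in>I. l i - x) * of_bool (even (card I))
      + (\<Sum>i\<in>I. (\<Prod>i\<in>I. l i - x) * (sgn (l i - x) * (\<Prod>k\<in>I - {i}. sgn (l k - l i))))"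
    using prod_sgn_diff[OF assms inj] False by (simp add: distrib_left sum_distrib_left)
  finally have "vdm I l * (\<Prod>i\<in>I. \<bar>l i - x\<bar>) = of_bool (even (card I)) * vdm I l * (\<Prod>i\<in>I. l i - x)
    + (\<Sum>i\<in>I. vdm I l * ((\<Prod>i\<in>I. l i - x) * (sgn (l i - x) * (\<Prod>k\<in>I - {i}. sgn (l k - l i)))))"
    by (simp add: distrib_left sum_distrib_left mult_ac)
  also have "(\<Sum>i\<in>I. vdm I l * ((\<Prod>i\<in>I. l i - x) * (sgn (l i - x) * (\<Prod>k\<in>I - {i}. sgn (l k - l i)))))
    = (\<Sum>i\<in>I. \<bar>l i - x\<bar> * (vdm (I - {i}) l * (\<Prod>k\<in>I - {i}. (l k - x) * (l k - l i))))"
  proof (intro sum.cong refl)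
    fix i assume i: "i \<in> I"
    have "(\<Prod>k\<in>I - {i}. (l k - x) * (l k - l i))
        = (\<Prod>k\<in>I - {i}. l k - x) * ((\<Prod>k\<in>I - {i}. \<bar>l k - l i\<bar>) * (\<Prod>k\<in>I - {i}. sgn (l k - l i)))"
      unfolding prod.distrib[symmetric]
      by (intro prod.cong refl) (auto simp: sgn_real_def)
    moreover have "(\<Prod>i\<in>I. l i - x) = (l i - x) * (\<Prod>k\<in>I - {i}. l k - x)"
      using i assms by (rule prod.remove[rotated])
    moreover have "\<bar>l i - x\<bar> = (l i - x) * sgn (l i - x)" by (simp add: abs_sgn)
    ultimately show "vdm I l * ((\<Prod>i\<in>I. l i - x) * (sgn (l i - x) * (\<Prod>k\<in>I - {i}. sgn (l k - l i))))
      = \<bar>l i - x\<bar> * (vdm (I - {i}) l * (\<Prod>k\<in>I - {i}. (l k - x) * (l k - l i)))"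
      using vdm_remove[OF assms i, of l] by (simp only: mult_ac)
  qed
  finally show ?thesis .
qed

text \<open>Polynomial growth of the coefficients allows averaging term by term. The constant top
  coefficient lets the average of one characteristic polynomial be read off from averages of
  products of two coefficients.\<close>

lemma prod_diff_He_expansion:
  assumes "finite I" "J \<subseteq> I"
  shows "\<exists>e. (\<forall>j. poly_growth I (e j)) \<and> (\<forall>l. e (card J) l = (-1) ^ card J) \<and> (\<forall>j l. card J < j \<longrightarrow> e j l = 0)
    \<and> (\<forall>l x. (\<Prod>i\<in>J. l i - x) = (\<Sum>j\<le>card J. e j l * He j x))"
proof -
  have "finite J" using assms finite_subset by blast
  then show ?thesis
    using assms(2)
  proof (induction J)
    case empty
    show ?case
      by (rule exI[of _ "\<lambda>j l. of_bool (j = 0)"]) (auto intro: poly_growth_const)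
  next
    case (insert i J)
    define n where "n = card J"
    from insert.prems have "J \<subseteq> I" by simp
    from insert.IH[OF this] obtain e where "(\<forall>j. poly_growth I (e j)) \<and> (\<forall>l. e n l = (-1) ^ n)
        \<and> (\<forall>j l. n < j \<longrightarrow> e j l = 0) \<and> (\<forall>l x. (\<Prod>i\<in>J. l i - x) = (\<Sum>j\<le>n. e j l * He j x))"
      unfolding n_def by (elim exE)
    then have e: "\<And>j. poly_growth I (e j)" "\<And>l. e n l = (-1) ^ n" "\<And>j l. n < j \<Longrightarrow> e j l = 0"
      "\<And>l x. (\<Prod>i\<in>J. l i - x) = (\<Sum>j\<le>n. e j l * He j x)"
      by simp_all
    \<comment> \<open>Coefficients of (l_i - x) times the old expansion, from x He_j = He_(j+1) + j
      He_(j-1).\<close>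
    define e' where "e' j l = l i * e j l - (if j = 0 then 0 else e (j - 1) l) - real (Suc j) * e (Suc j) l" for j l
    have card: "card (insert i J) = Suc n" using insert by (simp add: n_def)
    have "poly_growth I (e' j)" for j
      using insert.prems assms(1) e(1) unfolding e'_def[abs_def]
      by (cases "j = 0") (auto intro!: poly_growth_intros)
    moreover have "e' (Suc n) l = (-1) ^ Suc n" for l
      by (simp add: e'_def e)
    moreover have "e' j l = 0" if "Suc n < j" for j l
      using that by (simp add: e'_def e)
    moreover have "(\<Prod>i\<in>insert i J. l i - x) = (\<Sum>j\<le>Suc n. e' j l * He j x)" for l x
    proof -
      have 1: "(\<Sum>j\<le>Suc n. (if j = 0 then 0 else e (j - 1) l) * He j x) = (\<Sum>j\<le>n. e j l * He (Suc j) x)"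
        by (simp add: sum.atMost_Suc_shift del: sum.atMost_Suc)
      have 2: "(\<Sum>j\<le>Suc n. real (Suc j) * e (Suc j) l * He j x) = (\<Sum>j\<le>n. real j * e j l * He (j - 1) x)"
      proof -
        have "(\<Sum>j\<le>n. real j * e j l * He (j - 1) x) = (\<Sum>j\<le>Suc (Suc n). real j * e j l * He (j - 1) x)"
          by (simp add: e(3))
        also have "\<dots> = (\<Sum>j\<le>Suc n. real (Suc j) * e (Suc j) l * He j x)"
          by (subst sum.atMost_Suc_shift) simp
        finally show ?thesis by simp
      qed
      have "(\<Sum>j\<le>Suc n. e' j l * He j x) = l i * (\<Sum>j\<le>Suc n. e j l * He j x)
          - (\<Sum>j\<le>Suc n. (if j = 0 then 0 else e (j - 1) l) * He j x)
          - (\<Sum>j\<le>Suc n. real (Suc j) * e (Suc j) l * He j x)"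
        unfolding e'_def left_diff_distrib sum_subtractf by (simp only: sum_distrib_left mult.assoc)
      also have "\<dots> = (\<Sum>j\<le>n. l i * (e j l * He j x) - e j l * He (Suc j) x - real j * e j l * He (j - 1) x)"
        unfolding 1 2 by (simp add: e(3) sum_subtractf sum_distrib_left)
      also have "\<dots> = (\<Sum>j\<le>n. (l i - x) * (e j l * He j x))"
        by (intro sum.cong refl) (simp add: He_Suc algebra_simps)
      finally show ?thesis
        using insert.hyps by (simp add: e(4) sum_distrib_left)
    qed
    ultimately show ?case unfolding card by blast
  qed
qed

lemma DERIV_prod_diff:
  assumes "finite J"
  shows "((\<lambda>x. \<Prod>k\<in>J. l k - x :: real) has_real_derivative - (\<Sum>i\<in>J. \<Prod>k\<in>J - {i}. l k - x)) (at x)"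
proof -
  have "((\<lambda>x. \<Prod>k\<in>J. l k - x) has_derivative (\<lambda>h. \<Sum>i\<in>J. - h * (\<Prod>k\<in>J - {i}. l k - x))) (at x)"
    by (rule has_derivative_prod) (auto intro!: derivative_eq_intros)
  then show ?thesis
    unfolding has_field_derivative_def
    by (rule back_subst[of "\<lambda>d. ((\<lambda>x. \<Prod>k\<in>J. l k - x) has_derivative d) (at x)"])
      (simp add: fun_eq_iff sum_distrib_left sum_negf mult.commute)
qed

lemma sum_offdiag_swap:
  assumes "finite I"
  shows "(\<Sum>i\<in>I. \<Sum>k\<in>I - {i}. g i k) = (\<Sum>i\<in>I. \<Sum>k\<in>I - {i}. g k i)"
proof -
  have "I - {i} = {k. k \<in> I \<and> i \<noteq> k}" "I - {i} = {k. k \<in> I \<and> k \<noteq> i}" for i by auto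
  then show ?thesis
    using sum.swap_restrict[OF assms assms, of g "(\<noteq>)"] by simp
qed

text \<open>Pairing (i, m) with (m, i), the two fractions add up to -1 and the singular denominators
  disappear. The right-hand side is minus the second derivative of the product of all l_k -
  x.\<close>

lemma sum_offdiag_prod_diff:
  fixes l :: "'a \<Rightarrow> real"
  assumes "finite I" "inj_on l I"
  shows "2 * (\<Sum>i\<in>I. (\<Prod>k\<in>I - {i}. l k - x) * (\<Sum>k\<in>I - {i}. 1 / (l i - l k)))
    = - (\<Sum>i\<in>I. \<Sum>m\<in>I - {i}. \<Prod>k\<in>I - {i} - {m}. l k - x)"
proof -
  let ?P = "\<lambda>i m. \<Prod>k\<in>I - {i} - {m}. l k - x"
  let ?g = "\<lambda>i m. ?P i m * ((l m - x) / (l i - l m))"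
  have eq: "(\<Sum>i\<in>I. (\<Prod>k\<in>I - {i}. l k - x) * (\<Sum>k\<in>I - {i}. 1 / (l i - l k))) = (\<Sum>i\<in>I. \<Sum>m\<in>I - {i}. ?g i m)"
  proof (intro sum.cong refl)
    fix i
    have "(\<Prod>k\<in>I - {i}. l k - x) * (1 / (l i - l m)) = ?g i m" if "m \<in> I - {i}" for m
    proof -
      have "(\<Prod>k\<in>I - {i}. l k - x) = (l m - x) * ?P i m"
        using assms that by (intro prod.remove) auto
      then show ?thesis by simp
    qed
    then show "(\<Prod>k\<in>I - {i}. l k - x) * (\<Sum>k\<in>I - {i}. 1 / (l i - l k)) = (\<Sum>m\<in>I - {i}. ?g i m)"
      unfolding sum_distrib_left by (intro sum.cong refl)
  qed
  have "2 * (\<Sum>i\<in>I. \<Sum>m\<in>I - {i}. ?g i m) = (\<Sum>i\<in>I. \<Sum>m\<in>I - {i}. ?g i m + ?g m i)"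
    using sum_offdiag_swap[OF assms(1), of ?g] by (simp add: sum.distrib)
  also have "\<dots> = (\<Sum>i\<in>I. \<Sum>m\<in>I - {i}. - ?P i m)"
  proof (intro sum.cong refl)
    fix i m assume "i \<in> I" "m \<in> I - {i}"
    then have "l i - l m \<noteq> 0" "l m - l i \<noteq> 0" using assms(2) by (auto dest: inj_onD)
    then have "(l m - x) / (l i - l m) + (l i - x) / (l m - l i) = - 1"
      by (simp add: divide_simps) (simp add: algebra_simps)
    moreover have "?P m i = ?P i m" by (intro prod.cong) auto
    then have "?g i m + ?g m i = ?P i m * ((l m - x) / (l i - l m) + (l i - x) / (l m - l i))"
      by (simp only: distrib_left)
    ultimately show "?g i m + ?g m i = - ?P i m" by simp
  qed
  finally show ?thesis unfolding eq by (simp add: sum_negf)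
qed

section \<open>Averages of products of characteristic polynomials\<close>

text \<open>Unnormalised GOE average over any index set: it serves the N - 1 points besides x as
  well as the N - 2 points besides x and y.\<close>

definition goe_int :: "nat set \<Rightarrow> ((nat \<Rightarrow> real) \<Rightarrow> real) \<Rightarrow> real" where
  "goe_int I f = (\<integral>l. (\<Prod>i\<in>I. gauss (l i)) * (vdm I l * f l) \<partial>lborel_PiM I)"

lemma goe_int_integrable:
  assumes "finite I" "poly_growth I f"
  shows "integrable (lborel_PiM I) (\<lambda>l. (\<Prod>i\<in>I. gauss (l i)) * (vdm I l * f l))"
  using assms by (intro poly_growth_integrable poly_growth_mult poly_growth_vdm) auto

lemma goe_int_add:
  assumes "finite I" "poly_growth I f" "poly_growth I g"
  shows "goe_int I (\<lambda>l. f l + g l) = goe_int I f + goe_int I g"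
  using goe_int_integrable[OF assms(1,2)] goe_int_integrable[OF assms(1,3)]
  by (simp add: goe_int_def distrib_left)

lemma goe_int_sum:
  assumes "finite I" "\<And>a. a \<in> A \<Longrightarrow> poly_growth I (f a)"
  shows "goe_int I (\<lambda>l. \<Sum>a\<in>A. f a l) = (\<Sum>a\<in>A. goe_int I (f a))"
  using assms(2)
proof (induction A rule: infinite_finite_induct)
  case (insert a A)
  then show ?case
    using goe_int_add[OF assms(1), of "f a" "\<lambda>l. \<Sum>a\<in>A. f a l"] by (auto intro: poly_growth_sum)
qed (simp_all add: goe_int_def)

lemma goe_int_mult_right: "goe_int I (\<lambda>l. f l * c) = goe_int I f * c"
proof -
  have "(\<Prod>i\<in>I. gauss (l i)) * (vdm I l * (f l * c)) = ((\<Prod>i\<in>I. gauss (l i)) * (vdm I l * f l)) * c" for l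
    by (simp add: mult_ac)
  then show ?thesis
    unfolding goe_int_def by (simp only: integral_mult_left_zero)
qed

text \<open>Pointwise source of the dual equation: the derivatives from
  \<open>goe_integration_by_parts\<close>, summed over i, give the dual operator applied to the
  product of the characteristic polynomials at x and y. Where \<open>vdm\<close> is 0 both sides
  vanish.\<close>

lemma goe_dual_average_pde_integrand:
  fixes l :: "nat \<Rightarrow> real" and x y :: real
  assumes fin: "finite I" and e: "\<And>x. (\<Prod>i\<in>I. l i - x) = (\<Sum>j\<le>card I. e j * He j x)"
  shows "- 2 * (x - y) * (\<Sum>i\<in>I. vdm I l * (\<Prod>k\<in>I - {i}. (l k - x) * (l k - y))
      * (1 + (l i - y) * ((\<Sum>k\<in>I - {i}. 1 / (l i - l k)) - l i / 2)))
    = vdm I l * (\<Sum>j\<le>card I. \<Sum>k\<le>card I. e j * e k * ((x - y) * real (card I - j) * He j x * He k y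
        + 2 * (real j * He (j - 1) x * He k y - real k * He j x * He (k - 1) y)))"
proof (cases "vdm I l = 0")
  case False
  define n where "n = card I"
  have inj: "inj_on l I"
    using False vdm_eq_0[OF fin] by (auto intro!: inj_onI)
  \<comment> \<open>\<open>AA\<close> is the characteristic polynomial and \<open>A i\<close> omits
    its root \<open>l i\<close>; it is shown below that \<open>A1\<close> is minus the first and
    \<open>A2\<close> the second derivative of \<open>AA\<close>.\<close>
  define A where "A i x = (\<Prod>k\<in>I - {i}. l k - x)" for i x
  define AA where "AA x = (\<Prod>k\<in>I. l k - x)" for x
  define A1 where "A1 x = (\<Sum>i\<in>I. A i x)" for x
  define A2 where "A2 x = (\<Sum>i\<in>I. \<Sum>m\<in>I - {i}. \<Prod>k\<in>I - {i} - {m}. l k - x)" for x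
  have AA: "AA x = (\<Sum>j\<le>n. e j * He j x)" for x
    using e by (simp add: AA_def n_def)
  have remove: "(l i - x) * A i x = AA x" if "i \<in> I" for i x
    using fin that by (simp add: A_def AA_def prod.remove)
  have A1: "- A1 x = (\<Sum>j\<le>n. e j * (real j * He (j - 1) x))" for x
  proof (rule DERIV_unique)
    show "(AA has_real_derivative - A1 x) (at x)"
      using DERIV_prod_diff[OF fin, of l x] by (simp add: AA_def[abs_def] A1_def A_def)
    show "(AA has_real_derivative (\<Sum>j\<le>n. e j * (real j * He (j - 1) x))) (at x)"
      unfolding AA[abs_def] by (auto intro!: derivative_eq_intros simp: mult_ac)
  qed
  have A2: "A2 x = (\<Sum>j\<le>n. e j * (real j * (real (j - 1) * He (j - 2) x)))" for x
  proof (rule DERIV_unique)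
    have "((\<lambda>x. - A1 x) has_real_derivative - (\<Sum>i\<in>I. - (\<Sum>m\<in>I - {i}. \<Prod>k\<in>I - {i} - {m}. l k - x))) (at x)"
      unfolding A1_def A_def by (intro derivative_intros DERIV_prod_diff) (use fin in auto)
    then show "((\<lambda>x. - A1 x) has_real_derivative A2 x) (at x)"
      by (simp add: A2_def sum_negf)
    show "((\<lambda>x. - A1 x) has_real_derivative (\<Sum>j\<le>n. e j * (real j * (real (j - 1) * He (j - 2) x)))) (at x)"
      unfolding A1 by (auto intro!: derivative_eq_intros simp: numeral_2_eq_2 mult_ac)
  qed
  \<comment> \<open>By Hermite's equation, f'' - x f' + n f multiplies the coefficient of He_j by n
    - j.\<close>
  have ode: "A2 x + x * A1 x + real n * AA x = (\<Sum>j\<le>n. real (n - j) * e j * He j x)"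
  proof -
    have "A2 x - x * (- A1 x) + real n * AA x
        = (\<Sum>j\<le>n. e j * (real j * (real (j - 1) * He (j - 2) x) - x * (real j * He (j - 1) x)) + real n * (e j * He j x))"
      unfolding A1 A2 AA by (simp add: sum_distrib_left sum.distrib sum_subtractf algebra_simps)
    also have "\<dots> = (\<Sum>j\<le>n. real (n - j) * e j * He j x)"
      unfolding He_ode by (intro sum.cong refl) (simp add: of_nat_diff algebra_simps)
    finally show ?thesis by simp
  qed
  have "(\<Sum>j\<le>n. \<Sum>k\<le>n. e j * e k * ((x - y) * real (n - j) * He j x * He k y
        + 2 * (real j * He (j - 1) x * He k y - real k * He j x * He (k - 1) y)))
      = (\<Sum>j\<le>n. \<Sum>k\<le>n. (x - y) * ((real (n - j) * e j * He j x) * (e k * He k y))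
        + 2 * ((e j * (real j * He (j - 1) x)) * (e k * He k y) - (e j * He j x) * (e k * (real k * He (k - 1) y))))"
    by (intro sum.cong refl) (simp add: algebra_simps)
  also have "\<dots> = (x - y) * ((\<Sum>j\<le>n. real (n - j) * e j * He j x) * (\<Sum>k\<le>n. e k * He k y))
        + 2 * ((\<Sum>j\<le>n. e j * (real j * He (j - 1) x)) * (\<Sum>k\<le>n. e k * He k y)
          - (\<Sum>j\<le>n. e j * He j x) * (\<Sum>k\<le>n. e k * (real k * He (k - 1) y)))"
    unfolding sum_product by (simp only: sum.distrib sum_subtractf sum_distrib_left right_diff_distrib)
  also have "\<dots> = (x - y) * ((A2 x + x * A1 x + real n * AA x) * AA y) + 2 * (- A1 x * AA y + AA x * A1 y)"
    unfolding ode[symmetric] A1[symmetric] AA[symmetric] by simp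
  finally have rhs: "(\<Sum>j\<le>n. \<Sum>k\<le>n. e j * e k * ((x - y) * real (n - j) * He j x * He k y
        + 2 * (real j * He (j - 1) x * He k y - real k * He j x * He (k - 1) y)))
     = (x - y) * ((A2 x + x * A1 x + real n * AA x) * AA y) + 2 * (- A1 x * AA y + AA x * A1 y)" .
  define C where "C = (x - y) * AA y"
  \<comment> \<open>Rests on (x - y) A_i(x) A_i(y) = A_i(x) AA(y) - AA(x) A_i(y) and l_i A_i(x) =
    AA(x) + x A_i(x), both consequences of \<open>remove\<close>.\<close>
  have summand: "- 2 * (x - y) * ((\<Prod>k\<in>I - {i}. (l k - x) * (l k - y))
      * (1 + (l i - y) * ((\<Sum>k\<in>I - {i}. 1 / (l i - l k)) - l i / 2)))
    = 2 * (AA x * A i y - A i x * AA y)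
      - C * (2 * (A i x * (\<Sum>k\<in>I - {i}. 1 / (l i - l k))))
      + C * (AA x + x * A i x)" if "i \<in> I" for i
  proof -
    have "(\<Prod>k\<in>I - {i}. (l k - x) * (l k - y)) = A i x * A i y"
      by (simp add: A_def prod.distrib)
    then show ?thesis
      unfolding remove[OF that, symmetric] C_def by (simp add: field_simps)
  qed
  have "- 2 * (x - y) * (\<Sum>i\<in>I. (\<Prod>k\<in>I - {i}. (l k - x) * (l k - y))
      * (1 + (l i - y) * ((\<Sum>k\<in>I - {i}. 1 / (l i - l k)) - l i / 2)))
    = (\<Sum>i\<in>I. 2 * (AA x * A i y - A i x * AA y)
      - C * (2 * (A i x * (\<Sum>k\<in>I - {i}. 1 / (l i - l k))))
      + C * (AA x + x * A i x))"
    unfolding sum_distrib_left[of "- 2 * (x - y)"] by (intro sum.cong refl summand)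
  also have "\<dots> = 2 * (AA x * A1 y - A1 x * AA y)
      - C * (2 * (\<Sum>i\<in>I. A i x * (\<Sum>k\<in>I - {i}. 1 / (l i - l k))))
      + C * (real n * AA x + x * A1 x)"
    by (simp add: A1_def n_def sum.distrib sum_subtractf sum_distrib_left[symmetric] sum_distrib_right[symmetric])
  also have "2 * (\<Sum>i\<in>I. A i x * (\<Sum>k\<in>I - {i}. 1 / (l i - l k))) = - A2 x"
    unfolding A_def A2_def by (rule sum_offdiag_prod_diff[OF fin inj])
  finally have lhs: "- 2 * (x - y) * (\<Sum>i\<in>I. (\<Prod>k\<in>I - {i}. (l k - x) * (l k - y))
      * (1 + (l i - y) * ((\<Sum>k\<in>I - {i}. 1 / (l i - l k)) - l i / 2)))
     = (x - y) * ((A2 x + x * A1 x + real n * AA x) * AA y) + 2 * (- A1 x * AA y + AA x * A1 y)"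
    by (simp add: C_def algebra_simps)
  show ?thesis
    unfolding n_def[symmetric] rhs lhs[symmetric] mult.assoc[of "vdm I l"] sum_distrib_left[of "vdm I l", symmetric]
    by (simp only: mult_ac)
qed simp

text \<open>The averaged coefficient products form a symmetric array obeying the dual equation,
  which \<open>dual_pde_solution\<close> determines up to a constant. For a single characteristic
  polynomial the coefficients are, up to sign, column n of the same array, where only the diagonal
  entry survives.\<close>

lemma goe_dual_average:
  assumes fin: "finite I"
  shows "\<exists>\<alpha>. \<forall>x y. goe_int I (\<lambda>l. \<Prod>i\<in>I. (l i - x) * (l i - y))
       = \<alpha> * (\<Sum>j\<le>card I. real (Suc (card I) - j) / fact j * He j x * He j y)"
    and "\<exists>\<beta>. \<forall>x. goe_int I (\<lambda>l. \<Prod>i\<in>I. l i - x) = \<beta> * He (card I) x"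
proof -
  define n where "n = card I"
  obtain e where "(\<forall>j. poly_growth I (e j)) \<and> (\<forall>l. e n l = (-1) ^ n)
      \<and> (\<forall>j l. n < j \<longrightarrow> e j l = 0) \<and> (\<forall>l x. (\<Prod>i\<in>I. l i - x) = (\<Sum>j\<le>n. e j l * He j x))"
    using prod_diff_He_expansion[OF fin order_refl] unfolding n_def by (elim exE)
  then have e: "\<And>j. poly_growth I (e j)" "\<And>l. e n l = (-1) ^ n"
    "\<And>l x. (\<Prod>i\<in>I. l i - x) = (\<Sum>j\<le>n. e j l * He j x)"
    by simp_all
  define a where "a j k = goe_int I (\<lambda>l. e j l * e k l)" for j k
  have sym: "a j k = a k j" for j k
    by (simp add: a_def mult.commute)
  have pg: "poly_growth I (\<lambda>l. e j l * e k l * c)" for j k c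
    by (intro poly_growth_intros e)
  have pde: "(\<Sum>j\<le>n. \<Sum>k\<le>n. a j k * ((x - y) * real (n - j) * He j x * He k y
        + 2 * (real j * He (j - 1) x * He k y - real k * He j x * He (k - 1) y))) = 0" for x y
  proof -
    define c where "c j k = (x - y) * real (n - j) * He j x * He k y
        + 2 * (real j * He (j - 1) x * He k y - real k * He j x * He (k - 1) y)" for j k
    define F where "F i l = vdm I l * (\<Prod>k\<in>I - {i}. (l k - x) * (l k - y))
      * (1 + (l i - y) * ((\<Sum>k\<in>I - {i}. 1 / (l i - l k)) - l i / 2))" for i l
    have h: "poly_growth I (\<lambda>l. \<Prod>k\<in>I - {i}. (l k - x) * (l k - y))" for i
      using fin by (intro poly_growth_intros) auto
    have h': "(\<Prod>k\<in>I - {i}. ((l(i := t)) k - x) * ((l(i := t)) k - y)) = (\<Prod>k\<in>I - {i}. (l k - x) * (l k - y))"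
      for i t and l :: "nat \<Rightarrow> real"
      by (intro prod.cong) auto
    have F: "poly_growth I (F i)" "(\<integral>l. (\<Prod>j\<in>I. gauss (l j)) * F i l \<partial>lborel_PiM I) = 0" if "i \<in> I" for i
      unfolding F_def[abs_def]
      by (rule goe_integration_by_parts[where h = "\<lambda>l. \<Prod>k\<in>I - {i}. (l k - x) * (l k - y)", OF fin that h h'])+
    have "(\<Sum>j\<le>n. \<Sum>k\<le>n. a j k * c j k) = goe_int I (\<lambda>l. \<Sum>j\<le>n. \<Sum>k\<le>n. e j l * e k l * c j k)"
      unfolding a_def by (simp add: goe_int_sum fin pg poly_growth_sum goe_int_mult_right)
    \<comment> \<open>By the pointwise identity the integrand is a combination of total derivatives,
      each of integral 0.\<close>
    also have "\<dots> = (\<integral>l. - 2 * (x - y) * (\<Sum>i\<in>I. (\<Prod>j\<in>I. gauss (l j)) * F i l) \<partial>lborel_PiM I)"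
      unfolding goe_int_def
    proof (intro Bochner_Integration.integral_cong refl)
      fix l
      have "vdm I l * (\<Sum>j\<le>n. \<Sum>k\<le>n. e j l * e k l * c j k) = - 2 * (x - y) * (\<Sum>i\<in>I. F i l)"
        unfolding c_def F_def n_def
        by (rule goe_dual_average_pde_integrand[OF fin, symmetric]) (use e in \<open>simp add: n_def\<close>)
      then show "(\<Prod>i\<in>I. gauss (l i)) * (vdm I l * (\<Sum>j\<le>n. \<Sum>k\<le>n. e j l * e k l * c j k))
          = - 2 * (x - y) * (\<Sum>i\<in>I. (\<Prod>j\<in>I. gauss (l j)) * F i l)"
        unfolding sum_distrib_left[symmetric] by (simp only: mult_ac)
    qed
    also have "\<dots> = - 2 * (x - y) * (\<Sum>i\<in>I. \<integral>l. (\<Prod>j\<in>I. gauss (l j)) * F i l \<partial>lborel_PiM I)"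
      by (simp add: Bochner_Integration.integral_sum F poly_growth_integrable fin)
    also have "\<dots> = 0" by (simp add: F)
    finally show ?thesis unfolding c_def .
  qed
  note sol = dual_pde_solution[OF sym pde]
  define \<alpha> where "\<alpha> = a 0 0 / real (Suc n)"
  show "\<exists>\<alpha>. \<forall>x y. goe_int I (\<lambda>l. \<Prod>i\<in>I. (l i - x) * (l i - y))
       = \<alpha> * (\<Sum>j\<le>card I. real (Suc (card I) - j) / fact j * He j x * He j y)"
  proof (intro exI allI)
    fix x y
    have "goe_int I (\<lambda>l. \<Prod>i\<in>I. (l i - x) * (l i - y))
        = goe_int I (\<lambda>l. \<Sum>j\<le>n. \<Sum>k\<le>n. e j l * e k l * (He j x * He k y))"
      unfolding prod.distrib e(3) sum_product by (simp only: mult_ac)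
    also have "\<dots> = (\<Sum>j\<le>n. \<Sum>k\<le>n. a j k * (He j x * He k y))"
      unfolding a_def by (simp add: goe_int_sum fin pg poly_growth_sum goe_int_mult_right)
    also have "\<dots> = (\<Sum>j\<le>n. \<alpha> * (real (Suc n - j) / fact j * He j x * He j y))"
    proof (intro sum.cong refl)
      fix j assume j: "j \<in> {..n}"
      have "(\<Sum>k\<le>n. a j k * (He j x * He k y)) = a j j * (He j x * He j y)"
        using j sol(1)[of j] by (subst sum.remove[of _ j]) (auto intro!: sum.neutral)
      then show "(\<Sum>k\<le>n. a j k * (He j x * He k y)) = \<alpha> * (real (Suc n - j) / fact j * He j x * He j y)"
        using sol(2)[of j] j by (simp only: \<alpha>_def atMost_iff mult.assoc)
    qed
    finally show "goe_int I (\<lambda>l. \<Prod>i\<in>I. (l i - x) * (l i - y))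
       = \<alpha> * (\<Sum>j\<le>card I. real (Suc (card I) - j) / fact j * He j x * He j y)"
      by (simp add: sum_distrib_left n_def)
  qed
  show "\<exists>\<beta>. \<forall>x. goe_int I (\<lambda>l. \<Prod>i\<in>I. l i - x) = \<beta> * He (card I) x"
  proof (intro exI allI)
    fix x
    \<comment> \<open>A factor \<open>e n\<close> is inserted through its constant value (-1)^n,
      whose square is 1.\<close>
    have "goe_int I (\<lambda>l. \<Prod>i\<in>I. l i - x) = goe_int I (\<lambda>l. \<Sum>j\<le>n. e j l * e n l * ((-1) ^ n * He j x))"
    proof -
      have "e j l * He j x = e j l * e n l * ((-1) ^ n * He j x)" for j l
      proof -
        have "(-1) ^ n * (-1) ^ n = (1::real)" by (simp add: power_add[symmetric])
        then show ?thesis unfolding e(2) by (simp add: mult_ac)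
      qed
      then show ?thesis
        unfolding e(3) by (intro arg_cong[where f = "goe_int I"] ext sum.cong refl)
    qed
    also have "\<dots> = (\<Sum>j\<le>n. a j n * ((-1) ^ n * He j x))"
      unfolding a_def by (simp add: goe_int_sum fin pg poly_growth_sum goe_int_mult_right)
    also have "\<dots> = a n n * ((-1) ^ n * He n x)"
      using sol(1)[of _ n] by (subst sum.remove[of _ n]) (auto intro!: sum.neutral)
    finally show "goe_int I (\<lambda>l. \<Prod>i\<in>I. l i - x) = (a n n * (-1) ^ n) * He (card I) x"
      by (simp add: n_def)
  qed
qed

section \<open>Oscillator functions and their sign transforms\<close>

definition psi :: "nat \<Rightarrow> real \<Rightarrow> real" where
  "psi k x = He k x * gauss x"

lemma psi_Suc: "psi (Suc k) x = x * psi k x - real k * psi (k - 1) x"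
  by (simp add: psi_def He_Suc algebra_simps)

lemma DERIV_psi:
  "(psi k has_real_derivative (real k * psi (k - 1) x - psi (Suc k) x) / 2) (at x)"
  unfolding psi_def[abs_def]
  by (auto intro!: derivative_eq_intros simp: He_Suc field_simps)

lemma continuous_on_psi: "continuous_on A (psi k)"
  using DERIV_psi by (meson DERIV_atLeastAtMost_imp_continuous_on DERIV_continuous continuous_at_imp_continuous_on)

lemma psi_measurable [measurable]: "psi k \<in> borel_measurable borel"
  by (intro borel_measurable_continuous_onI continuous_on_psi)

lemma psi_bound: "\<exists>C. \<forall>t. \<bar>psi k t\<bar> \<le> C * (1 + \<bar>t\<bar>) ^ k * gauss t"
proof -
  have "\<exists>C\<ge>0. \<forall>t. \<bar>He k t\<bar> \<le> C * (1 + \<bar>t\<bar>) ^ k"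
  proof (induction k rule: hermite.induct)
    case 1
    show ?case by (rule exI[of _ 1]) simp
  next
    case 2
    show ?case by (rule exI[of _ 1]) (simp add: He_Suc)
  next
    case (3 k)
    then obtain C D where C: "C \<ge> 0" "\<And>t. \<bar>He (Suc k) t\<bar> \<le> C * (1 + \<bar>t\<bar>) ^ Suc k"
      and D: "D \<ge> 0" "\<And>t. \<bar>He k t\<bar> \<le> D * (1 + \<bar>t\<bar>) ^ k" by blast
    have "\<bar>He (Suc (Suc k)) t\<bar> \<le> (C + real (Suc k) * D) * (1 + \<bar>t\<bar>) ^ Suc (Suc k)" for t
    proof -
      have "\<bar>He (Suc (Suc k)) t\<bar> \<le> \<bar>t\<bar> * \<bar>He (Suc k) t\<bar> + real (Suc k) * \<bar>He k t\<bar>"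
        unfolding He_Suc[of "Suc k"] by (rule order_trans[OF abs_triangle_ineq4]) (simp add: abs_mult)
      also have "\<dots> \<le> (1 + \<bar>t\<bar>) * (C * (1 + \<bar>t\<bar>) ^ Suc k) + real (Suc k) * (D * (1 + \<bar>t\<bar>) ^ Suc (Suc k))"
      proof (intro add_mono mult_mono C(2))
        have "(1 + \<bar>t\<bar>) ^ k \<le> (1 + \<bar>t\<bar>) ^ Suc (Suc k)" by (rule power_increasing) auto
        then show "\<bar>He k t\<bar> \<le> D * (1 + \<bar>t\<bar>) ^ Suc (Suc k)"
          using D by (meson mult_left_mono order_trans)
      qed auto
      finally show ?thesis by (simp add: algebra_simps)
    qed
    moreover have "0 \<le> C + real (Suc k) * D" using C D by simp
    ultimately show ?case by blast
  qed
  then obtain C where "\<And>t. \<bar>He k t\<bar> \<le> C * (1 + \<bar>t\<bar>) ^ k" by blast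
  then have "\<bar>psi k t\<bar> \<le> C * (1 + \<bar>t\<bar>) ^ k * gauss t" for t
    unfolding psi_def abs_mult using gauss_pos[of t] by (simp add: mult_right_mono)
  then show ?thesis by blast
qed

lemma integrable_sgn_psi: "integrable lborel (\<lambda>y. sgn (y - x) * psi k y)"
proof -
  obtain C where C: "\<And>t. \<bar>psi k t\<bar> \<le> C * (1 + \<bar>t\<bar>) ^ k * gauss t" using psi_bound by blast
  have "\<bar>sgn (t - x) * psi k t\<bar> \<le> \<bar>psi k t\<bar>" for t
    by (simp add: abs_mult sgn_real_def)
  then show ?thesis
    by (intro integrable_dominated_gauss[of _ C k]) (use C in \<open>auto intro: order_trans\<close>)
qed

lemma integrable_psi: "integrable lborel (psi k)"
proof -
  obtain C where "\<And>t. \<bar>psi k t\<bar> \<le> C * (1 + \<bar>t\<bar>) ^ k * gauss t" using psi_bound by blast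
  then show ?thesis by (intro integrable_dominated_gauss[of _ C k]) auto
qed

lemma psi_tendsto_0: "(psi k \<longlongrightarrow> 0) at_top" "(psi k \<longlongrightarrow> 0) at_bot"
  using psi_bound[of k] dominated_gauss_tendsto_0[of "psi k"] by blast+

text \<open>The integral to the right of x minus the integral to the left: -2 times an
  antiderivative of \<open>psi k\<close>, with the constant for which the recurrence
  \<open>eps_Suc\<close> holds.\<close>

definition eps :: "nat \<Rightarrow> real \<Rightarrow> real" where
  "eps k x = (\<integral>y. sgn (y - x) * psi k y \<partial>lborel)"

text \<open>Integrate psi_k' = (k psi_(k-1) - psi_(k+1)) / 2 against the sign; the jump at x
  contributes -2 psi_k(x).\<close>

lemma eps_Suc: "eps (Suc k) x = real k * eps (k - 1) x + 4 * psi k x"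
proof -
  \<comment> \<open>A continuous antiderivative of \<open>g'\<close> with a kink only at x: psi_k(y)
    - psi_k(x) on the right, the negative of that on the left.\<close>
  define g where "g y = psi k (max y x) - psi k (min y x)" for y
  define g' where "g' y = sgn (y - x) * ((real k * psi (k - 1) y - psi (Suc k) y) / 2)" for y
  have g': "g' y = (real k * (sgn (y - x) * psi (k - 1) y) - sgn (y - x) * psi (Suc k) y) / 2" for y
    by (simp add: g'_def algebra_simps)
  have "integral\<^sup>L lborel g' = (0 - psi k x) - (psi k x - 0)"
  proof (rule integral_deriv_real_line[of "{x}" g])
    show "continuous_on UNIV g"
      unfolding g_def
      by (intro continuous_on_diff continuous_on_compose2[OF continuous_on_psi] continuous_intros) auto
    show "(g has_real_derivative g' y) (at y)" if "y \<notin> {x}" for y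
    proof (cases "x < y")
      case True
      have "((\<lambda>y. psi k y - psi k x) has_real_derivative g' y) (at y)"
        unfolding g'_def using True by (auto intro!: derivative_eq_intros DERIV_psi)
      then show ?thesis
        by (rule has_field_derivative_transform_within_open[of _ _ _ "{x<..}"])
          (use True in \<open>auto simp: g_def max_def min_def\<close>)
    next
      case False
      have "((\<lambda>y. psi k x - psi k y) has_real_derivative g' y) (at y)"
        unfolding g'_def using False that by (auto intro!: derivative_eq_intros DERIV_psi simp: field_simps)
      then show ?thesis
        by (rule has_field_derivative_transform_within_open[of _ _ _ "{..<x}"])
          (use False that in \<open>auto simp: g_def max_def min_def\<close>)
    qed
    show "integrable lborel g'"
      unfolding g'[abs_def] using integrable_sgn_psi by auto
    have "\<forall>\<^sub>F y in at_top. psi k y - psi k x = g y"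
      using eventually_ge_at_top[of x] by eventually_elim (simp add: g_def max_def min_def)
    then show "(g \<longlongrightarrow> 0 - psi k x) at_top"
      by (rule Lim_transform_eventually[rotated]) (intro tendsto_intros psi_tendsto_0)
    have "\<forall>\<^sub>F y in at_bot. psi k x - psi k y = g y"
      using eventually_le_at_bot[of x] by eventually_elim (simp add: g_def max_def min_def)
    then show "(g \<longlongrightarrow> psi k x - 0) at_bot"
      by (rule Lim_transform_eventually[rotated]) (intro tendsto_intros psi_tendsto_0)
  qed simp
  moreover have "integral\<^sup>L lborel g' = (real k * eps (k - 1) x - eps (Suc k) x) / 2"
    unfolding g'[abs_def] eps_def using integrable_sgn_psi by simp
  ultimately show ?thesis by simp
qed

lemma DERIV_eps: "(eps k has_real_derivative - 2 * psi k x) (at x)"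
proof -
  define a where "a = x - 1"
  \<comment> \<open>Moving the jump from \<open>a\<close> to \<open>y\<close> flips the sign in
    between, which changes the integrand there by -2 \<open>psi k\<close>.\<close>
  have eq: "eps k a - 2 * integral {a..y} (psi k) = eps k y" if "a < y" for y
  proof -
    have set: "set_integrable lborel {a..y} (psi k)"
      unfolding set_integrable_def by (rule integrable_mult_indicator[OF _ integrable_psi]) simp
    have "eps k y = (\<integral>z. sgn (z - a) * psi k z - 2 * (indicator {a..y} z *\<^sub>R psi k z) \<partial>lborel)"
      unfolding eps_def
    proof (rule integral_cong_AE)
      have "AE z in lborel. z \<noteq> a \<and> z \<noteq> y"
        using AE_lborel_singleton[of a] AE_lborel_singleton[of y] by eventually_elim simp
      then show "AE z in lborel. sgn (z - y) * psi k z
          = sgn (z - a) * psi k z - 2 * (indicator {a..y} z *\<^sub>R psi k z)"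
        by eventually_elim (use that in \<open>auto simp: sgn_real_def indicator_def\<close>)
    qed auto
    also have "\<dots> = eps k a - 2 * (LINT z:{a..y}|lborel. psi k z)"
      using set integrable_sgn_psi[of a k] by (simp add: eps_def set_lebesgue_integral_def set_integrable_def)
    also have "(LINT z:{a..y}|lborel. psi k z) = integral {a..y} (psi k)"
      by (rule set_borel_integral_eq_integral(2)[OF set])
    finally show ?thesis by simp
  qed
  have "((\<lambda>y. integral {a..y} (psi k)) has_real_derivative psi k x) (at x within {a..x + 1})"
    by (rule integral_has_real_derivative[OF continuous_on_psi]) (auto simp: a_def)
  then have "((\<lambda>y. integral {a..y} (psi k)) has_real_derivative psi k x) (at x)"
    by (subst (asm) at_within_interior) (auto simp: a_def)
  then have "((\<lambda>y. eps k a - 2 * integral {a..y} (psi k)) has_real_derivative - 2 * psi k x) (at x)"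
    by (auto intro!: derivative_eq_intros)
  then show ?thesis
    by (rule has_field_derivative_transform_within_open[of _ _ _ "{a<..}"]) (use eq in \<open>auto simp: a_def\<close>)
qed

text \<open>
  For $N = n+1$ the bracket is $(N-1)! \sum_{k<N} \psi_k^2 / k!$ (Christoffel-Darboux on the diagonal).
\<close>

definition goe_density_core :: "nat \<Rightarrow> real \<Rightarrow> real" where
  "goe_density_core n x = 4 * (real (Suc n) * (psi n x)\<^sup>2 - x * psi n x * psi (Suc n) x + (psi (Suc n) x)\<^sup>2)
     - psi n x * eps (Suc n) x"

text \<open>By \<open>psi_Suc\<close> and \<open>eps_Suc\<close>, adding the next summand to the
  core and multiplying by n + 2 gives the next core. Sign transforms of all orders thus collapse to
  a single one.\<close>

lemma sum_psi_eps:
  "fact (Suc n) * (\<Sum>j\<le>n. (psi j x * eps (Suc j) x - psi (Suc j) x * eps j x) / fact j)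
    = goe_density_core (Suc n) x"
proof (induction n)
  case 0
  show ?case
    by (simp add: goe_density_core_def psi_Suc eps_Suc power2_eq_square algebra_simps)
next
  case (Suc n)
  have "fact (Suc (Suc n)) * (\<Sum>j\<le>Suc n. (psi j x * eps (Suc j) x - psi (Suc j) x * eps j x) / fact j)
    = real (Suc (Suc n)) * (goe_density_core (Suc n) x
        + (psi (Suc n) x * eps (Suc (Suc n)) x - psi (Suc (Suc n)) x * eps (Suc n) x))"
    unfolding Suc.IH[symmetric] by (simp add: fact_Suc distrib_left mult.assoc del: of_nat_Suc)
  also have "\<dots> = goe_density_core (Suc (Suc n)) x"
    unfolding goe_density_core_def
    by (simp add: psi_Suc[of "Suc (Suc n)"] psi_Suc[of "Suc n"] eps_Suc[of "Suc (Suc n)"] eps_Suc[of "Suc n"]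
        power2_eq_square algebra_simps)
  finally show ?case .
qed

section \<open>The one-point density\<close>

text \<open>|y - x| is -sgn(y - x) times the factor x - y that \<open>weighted_CD_sum\<close> needs.
  The Gaussians turn \<open>He\<close> into \<open>psi\<close>, and the sign is absorbed in
  \<open>eps\<close>.\<close>

lemma goe_dual_kernel_integral:
  "(\<integral>y. gauss x * (gauss y * (\<bar>y - x\<bar> * (\<Sum>j\<le>m. real (Suc m - j) / fact j * He j x * He j y))) \<partial>lborel)
    = goe_density_core (Suc m) x / fact (Suc m)"
proof -
  have "gauss x * (gauss y * (\<bar>y - x\<bar> * (\<Sum>j\<le>m. real (Suc m - j) / fact j * He j x * He j y)))
      = (\<Sum>j\<le>m. (psi j x * (sgn (y - x) * psi (Suc j) y) - psi (Suc j) x * (sgn (y - x) * psi j y)) / fact j)" for y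
  proof -
    have "\<bar>y - x\<bar> = - sgn (y - x) * (x - y)" by (simp add: sgn_real_def)
    then have "gauss x * (gauss y * (\<bar>y - x\<bar> * (\<Sum>j\<le>m. real (Suc m - j) / fact j * He j x * He j y)))
      = - sgn (y - x) * gauss x * gauss y * (\<Sum>j\<le>m. christoffel_num j x y / fact j)"
      unfolding weighted_CD_sum[symmetric] by (simp only: mult_ac)
    also have "\<dots> = (\<Sum>j\<le>m. (psi j x * (sgn (y - x) * psi (Suc j) y) - psi (Suc j) x * (sgn (y - x) * psi j y)) / fact j)"
      unfolding sum_distrib_left
      by (intro sum.cong refl) (simp add: christoffel_num_def psi_def diff_divide_distrib algebra_simps)
    finally show ?thesis .
  qed
  then have "(\<integral>y. gauss x * (gauss y * (\<bar>y - x\<bar> * (\<Sum>j\<le>m. real (Suc m - j) / fact j * He j x * He j y))) \<partial>lborel)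
      = (\<Sum>j\<le>m. (psi j x * eps (Suc j) x - psi (Suc j) x * eps j x) / fact j)"
    using integrable_sgn_psi by (simp add: eps_def)
  then show ?thesis
    by (simp add: sum_psi_eps[symmetric] del: fact_Suc)
qed

text \<open>Integrate \<open>vdm_prod_abs_diff\<close>. The parity term yields an averaged
  characteristic polynomial, hence \<open>psi\<close>. In summand i the variable y = l_i is
  integrated last, and the inner integral is a dual average of the other points, hence a multiple of
  the core.\<close>

lemma goe_one_point_weight:
  assumes fin: "finite I"
  shows "\<exists>c d. \<forall>x. gauss x * goe_int I (\<lambda>l. \<Prod>i\<in>I. \<bar>l i - x\<bar>)
    = c * goe_density_core (card I) x + d * psi (card I) x"
proof -
  define n where "n = card I"
  obtain \<beta> where \<beta>: "\<forall>x. goe_int I (\<lambda>l. \<Prod>i\<in>I. l i - x) = \<beta> * He (card I) x"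
    using goe_dual_average(2)[OF fin] by (elim exE)
  define T where "T x i l = \<bar>l i - x\<bar> * (vdm (I - {i}) l * (\<Prod>k\<in>I - {i}. (l k - x) * (l k - l i)))" for x i l
  have pg: "poly_growth I (T x i)" if "i \<in> I" for x i
    unfolding T_def using that fin by (intro poly_growth_intros poly_growth_vdm) auto
  have "\<exists>\<alpha>. \<forall>x. gauss x * (\<integral>l. (\<Prod>i\<in>I. gauss (l i)) * T x i l \<partial>lborel_PiM I) = \<alpha> * goe_density_core n x"
    if i: "i \<in> I" for i
  proof -
    define J where "J = I - {i}"
    have J: "finite J" "i \<notin> J" "I = insert i J" using fin i by (auto simp: J_def)
    obtain m where m: "card J = m" "n = Suc m"
      unfolding n_def J(3) using J(1,2) by simp
    obtain \<alpha> where "\<forall>x y. goe_int J (\<lambda>l. \<Prod>k\<in>J. (l k - x) * (l k - y))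
        = \<alpha> * (\<Sum>j\<le>card J. real (Suc (card J) - j) / fact j * He j x * He j y)"
      using goe_dual_average(1)[OF J(1)] by (elim exE)
    note \<alpha> = this[rule_format]
    have "gauss x * (\<integral>l. (\<Prod>i\<in>I. gauss (l i)) * T x i l \<partial>lborel_PiM I)
        = \<alpha> / fact n * goe_density_core n x" for x
    proof -
      have "(\<integral>l. (\<Prod>i\<in>I. gauss (l i)) * T x i l \<partial>lborel_PiM I)
          = (\<integral>y. \<integral>l. (\<Prod>j\<in>I. gauss ((l(i := y)) j)) * T x i (l(i := y)) \<partial>lborel_PiM J \<partial>lborel)"
        using lborel_PiM.product_integral_insert_rev[OF J(1,2), of "\<lambda>l. (\<Prod>j\<in>I. gauss (l j)) * T x i l"]
          poly_growth_integrable[OF fin pg[OF i]] by (simp add: J(3)[symmetric])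
      also have "\<dots> = (\<integral>y. gauss y * (\<bar>y - x\<bar> * goe_int J (\<lambda>l. \<Prod>k\<in>J. (l k - x) * (l k - y))) \<partial>lborel)"
      proof (intro Bochner_Integration.integral_cong refl)
        fix y
        have "(\<Prod>j\<in>I. gauss ((l(i := y)) j)) * T x i (l(i := y))
          = (gauss y * \<bar>y - x\<bar>) * ((\<Prod>j\<in>J. gauss (l j)) * (vdm J l * (\<Prod>k\<in>J. (l k - x) * (l k - y))))" for l
        proof -
          have g: "(\<Prod>j\<in>I. gauss ((l(i := y)) j)) = gauss y * (\<Prod>j\<in>J. gauss (l j))"
            using J by (auto intro!: prod.cong)
          have p: "(\<Prod>k\<in>J. ((l(i := y)) k - x) * ((l(i := y)) k - (l(i := y)) i)) = (\<Prod>k\<in>J. (l k - x) * (l k - y))"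
            using J by (intro prod.cong) auto
          show ?thesis
            unfolding T_def J_def[symmetric] g p vdm_fun_upd[OF J(2)] by (simp only: fun_upd_same mult_ac)
        qed
        then show "(\<integral>l. (\<Prod>j\<in>I. gauss ((l(i := y)) j)) * T x i (l(i := y)) \<partial>lborel_PiM J)
          = gauss y * (\<bar>y - x\<bar> * goe_int J (\<lambda>l. \<Prod>k\<in>J. (l k - x) * (l k - y)))"
          by (simp add: goe_int_def)
      qed
      finally have "gauss x * (\<integral>l. (\<Prod>i\<in>I. gauss (l i)) * T x i l \<partial>lborel_PiM I)
        = gauss x * (\<integral>y. gauss y * (\<bar>y - x\<bar> * goe_int J (\<lambda>l. \<Prod>k\<in>J. (l k - x) * (l k - y))) \<partial>lborel)"
        by (rule arg_cong)
      also have "\<dots> = (\<integral>y. \<alpha> * (gauss x * (gauss y * (\<bar>y - x\<bar> * (\<Sum>j\<le>m. real (Suc m - j) / fact j * He j x * He j y)))) \<partial>lborel)"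
        unfolding \<alpha> m(1) by (subst integral_mult_right_zero[symmetric]) (simp only: mult_ac)
      also have "\<dots> = \<alpha> / fact n * goe_density_core n x"
        unfolding m(2) by (rule trans[OF integral_mult_right_zero]) (simp only: goe_dual_kernel_integral, simp)
      finally show ?thesis .
    qed
    then show ?thesis by blast
  qed
  then obtain \<alpha> where \<alpha>: "\<And>i x. i \<in> I \<Longrightarrow>
      gauss x * (\<integral>l. (\<Prod>i\<in>I. gauss (l i)) * T x i l \<partial>lborel_PiM I) = \<alpha> i * goe_density_core n x"
    by metis
  show ?thesis
  proof (intro exI allI)
    fix x
    have "goe_int I (\<lambda>l. \<Prod>i\<in>I. \<bar>l i - x\<bar>)
      = (\<integral>l. of_bool (even n) * ((\<Prod>i\<in>I. gauss (l i)) * (vdm I l * (\<Prod>i\<in>I. l i - x)))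
          + (\<Sum>i\<in>I. (\<Prod>i\<in>I. gauss (l i)) * T x i l) \<partial>lborel_PiM I)"
      unfolding goe_int_def vdm_prod_abs_diff[OF fin] T_def n_def sum_distrib_left[symmetric]
      by (intro Bochner_Integration.integral_cong refl) (simp only: distrib_left mult_ac)
    also have "\<dots> = of_bool (even n) * goe_int I (\<lambda>l. \<Prod>i\<in>I. l i - x)
          + (\<Sum>i\<in>I. \<integral>l. (\<Prod>i\<in>I. gauss (l i)) * T x i l \<partial>lborel_PiM I)"
    proof -
      have "poly_growth I (\<lambda>l. \<Prod>i\<in>I. l i - x)"
        using fin by (intro poly_growth_intros)
      note goe_int_integrable[OF fin this]
      moreover have "integrable (lborel_PiM I) (\<lambda>l. (\<Prod>i\<in>I. gauss (l i)) * T x i l)" if "i \<in> I" for i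
        by (intro poly_growth_integrable fin pg that)
      ultimately show ?thesis
        unfolding goe_int_def
        by (subst Bochner_Integration.integral_add) (auto simp: Bochner_Integration.integral_sum)
    qed
    finally have "gauss x * goe_int I (\<lambda>l. \<Prod>i\<in>I. \<bar>l i - x\<bar>)
      = of_bool (even n) * \<beta> * psi n x
        + (\<Sum>i\<in>I. gauss x * (\<integral>l. (\<Prod>i\<in>I. gauss (l i)) * T x i l \<partial>lborel_PiM I))"
      by (simp add: \<beta> psi_def n_def distrib_left sum_distrib_left)
    also have "\<dots> = (\<Sum>i\<in>I. \<alpha> i) * goe_density_core n x + (of_bool (even n) * \<beta>) * psi n x"
      by (simp add: \<alpha> sum_distrib_right)
    finally show "gauss x * goe_int I (\<lambda>l. \<Prod>i\<in>I. \<bar>l i - x\<bar>)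
      = (\<Sum>i\<in>I. \<alpha> i) * goe_density_core (card I) x + (of_bool (even n) * \<beta>) * psi (card I) x"
      unfolding n_def .
  qed
qed

section \<open>The differential equation\<close>

lemma iterated_deriv_tower:
  fixes F :: "nat \<Rightarrow> real \<Rightarrow> real"
  assumes "\<And>k x. k < n \<Longrightarrow> (F k has_real_derivative F (Suc k) x) (at x)" "k \<le> n"
  shows "(deriv ^^ k) (F 0) = F k"
  using assms(2)
proof (induction k)
  case (Suc k)
  then have "deriv (F k) = F (Suc k)"
    by (intro ext DERIV_imp_deriv assms(1)) auto
  with Suc show ?case by simp
qed simp

text \<open>Meant for u = psi_(N-1) and v = psi_N. The scale \<open>c\<close> enters through the
  derivative of \<open>E\<close>, so \<open>E\<close> may contain an additive constant, which
  absorbs any multiple of \<open>u\<close> in the density.\<close>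

lemma goe_density_ode:
  fixes u v E :: "real \<Rightarrow> real" and c N :: real
  assumes u: "\<And>x. (u has_real_derivative x * u x / 2 - v x) (at x)"
    and v: "\<And>x. (v has_real_derivative N * u x - x * v x / 2) (at x)"
    and E: "\<And>x. (E has_real_derivative - 2 * c * v x) (at x)"
    and f: "\<And>x. f x = c * (4 * (N * (u x)\<^sup>2 - x * u x * v x + (v x)\<^sup>2)) - u x * E x"
  shows "(\<forall>k<5. \<forall>x. (deriv ^^ k) f differentiable (at x)) \<and>
    (\<forall>x. - 4 * (deriv ^^ 5) f x
         + 5 * (x^2 - 4 * N + 2) * (deriv ^^ 3) f x
         - 6 * x * (deriv ^^ 2) f x
         + (- (x^4) + (8 * N - 4) * x^2 - 16 * N^2 + 16 * N + 2) * deriv f x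
         + x * (x^2 - 4 * N + 2) * f x = 0)"
proof -
  \<comment> \<open>Coordinates in the module spanned by u^2, uv, v^2, uE and vE. The factor
    \<open>c\<close> on the quadratic part keeps the rules of \<open>step\<close> free of
    \<open>c\<close>, since differentiating \<open>E\<close> produces c v.\<close>
  define comb where "comb a b d p q x = c * (a x * (u x)\<^sup>2 + b x * (u x * v x) + d x * (v x)\<^sup>2)
    + p x * (u x * E x) + q x * (v x * E x)" for a b d p q x
  have step: "(comb a b d p q has_real_derivative comb A B D P Q x) (at x)"
    if "(a has_real_derivative a') (at x)" "(b has_real_derivative b') (at x)" "(d has_real_derivative d') (at x)"
      "(p has_real_derivative p') (at x)" "(q has_real_derivative q') (at x)"
      "A x = a' + x * a x + N * b x" "B x = b' - 2 * a x + 2 * N * d x - 2 * p x"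
      "D x = d' - b x - x * d x - 2 * q x" "P x = p' + x / 2 * p x + N * q x" "Q x = q' - p x - x / 2 * q x"
    for a b d p q A B D P Q :: "real \<Rightarrow> real" and a' b' d' p' q' x
  proof -
    have "(comb a b d p q has_real_derivative
        c * ((a' * (u x)\<^sup>2 + a x * (2 * u x * (x * u x / 2 - v x)))
          + (b' * (u x * v x) + b x * ((x * u x / 2 - v x) * v x + u x * (N * u x - x * v x / 2)))
          + (d' * (v x)\<^sup>2 + d x * (2 * v x * (N * u x - x * v x / 2))))
        + (p' * (u x * E x) + p x * ((x * u x / 2 - v x) * E x + u x * (- 2 * c * v x)))
        + (q' * (v x * E x) + q x * ((N * u x - x * v x / 2) * E x + v x * (- 2 * c * v x)))) (at x)"
      unfolding comb_def[abs_def]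
      by (rule derivative_eq_intros that(1-5) u v E refl)+ (simp add: algebra_simps)
    then show ?thesis
      by (rule back_subst[of "\<lambda>D. (comb a b d p q has_real_derivative D) (at x)"])
        (simp add: comb_def that(6-10) power2_eq_square field_simps)
  qed
  \<comment> \<open>\<open>f0\<close> encodes \<open>f\<close>; each following coefficient tuple
    comes from the preceding one by the rules of \<open>step\<close>.\<close>
  define f0 where "f0 = comb (\<lambda>x. 4 * N) (\<lambda>x. - 4 * x) (\<lambda>x. 4) (\<lambda>x. - 1) (\<lambda>x. 0)"
  define f1 where "f1 = comb (\<lambda>x. 0) (\<lambda>x. - 2) (\<lambda>x. 0) (\<lambda>x. - x / 2) (\<lambda>x. 1)"
  define f2 where "f2 = comb (\<lambda>x. - 2 * N) (\<lambda>x. x) (\<lambda>x. 0) (\<lambda>x. N - 1 / 2 - x ^ 2 / 4) (\<lambda>x. 0)"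
  define f3 where "f3 = comb (\<lambda>x. - N * x) (\<lambda>x. 2 * N + 2 + x ^ 2 / 2) (\<lambda>x. - x)
    (\<lambda>x. (N / 2 - 3 / 4) * x - x ^ 3 / 8) (\<lambda>x. 1 / 2 - N + x ^ 2 / 4)"
  define f4 where "f4 = comb (\<lambda>x. 2 * N ^ 2 + N - N / 2 * x ^ 2) (\<lambda>x. (5 / 2 - N) * x + x ^ 3 / 4) (\<lambda>x. - 4)
    (\<lambda>x. N - N ^ 2 - 3 / 4 + (N / 2 - 3 / 4) * x ^ 2 - x ^ 4 / 16) (\<lambda>x. x)"
  define f5 where "f5 = comb (\<lambda>x. (N ^ 2 + 5 / 2 * N) * x - N / 4 * x ^ 3)
    (\<lambda>x. 4 - 13 * N - 2 * N ^ 2 + 9 / 4 * x ^ 2 + x ^ 4 / 8) (\<lambda>x. (N - 1 / 2) * x - x ^ 3 / 4)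
    (\<lambda>x. (5 / 2 * N - N ^ 2 / 2 - 15 / 8) * x + (N / 4 - 5 / 8) * x ^ 3 - x ^ 5 / 32)
    (\<lambda>x. 7 / 4 - N + N ^ 2 + (1 / 4 - N / 2) * x ^ 2 + x ^ 4 / 16)"
  define F where "F k = [f0, f1, f2, f3, f4, f5] ! k" for k
  have "(f0 has_real_derivative f1 x) (at x)" for x
    unfolding f0_def f1_def
    by (rule step) (auto intro!: derivative_eq_intros simp: field_simps power2_eq_square)
  moreover have "(f1 has_real_derivative f2 x) (at x)" for x
    unfolding f1_def f2_def
    by (rule step) (auto intro!: derivative_eq_intros simp: field_simps power2_eq_square)
  moreover have "(f2 has_real_derivative f3 x) (at x)" for x
    unfolding f2_def f3_def
    by (rule step[where a' = 0 and b' = 1 and d' = 0 and p' = "- x / 2" and q' = 0])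
      (auto intro!: derivative_eq_intros simp: field_simps eval_nat_numeral)
  moreover have "(f3 has_real_derivative f4 x) (at x)" for x
    unfolding f3_def f4_def
    by (rule step[where a' = "- N" and b' = x and d' = "- 1" and p' = "(N / 2 - 3 / 4) - 3 / 8 * x ^ 2" and q' = "x / 2"])
      (auto intro!: derivative_eq_intros simp: field_simps eval_nat_numeral)
  moreover have "(f4 has_real_derivative f5 x) (at x)" for x
    unfolding f4_def f5_def
    by (rule step[where a' = "- N * x" and b' = "(5 / 2 - N) + 3 / 4 * x ^ 2" and d' = 0
        and p' = "(N - 3 / 2) * x - x ^ 3 / 4" and q' = 1])
      (auto intro!: derivative_eq_intros simp: field_simps eval_nat_numeral)
  ultimately have F: "(F k has_real_derivative F (Suc k) x) (at x)" if "k < 5" for k x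
    using that by (auto simp: F_def eval_nat_numeral less_Suc_eq)
  have "F 0 = f"
    by (simp add: F_def f0_def comb_def fun_eq_iff f algebra_simps)
  then have deriv: "(deriv ^^ k) f = F k" if "k \<le> 5" for k
    using iterated_deriv_tower[of 5 F, OF F that] by simp
  \<comment> \<open>Polynomial identities in x and N, one for each of the five products.
    \<open>f4\<close> is only the link to \<open>f5\<close>, as the equation has no fourth
    derivative.\<close>
  have "- 4 * F 5 x + 5 * (x^2 - 4 * N + 2) * F 3 x - 6 * x * F 2 x
      + (- (x^4) + (8 * N - 4) * x^2 - 16 * N^2 + 16 * N + 2) * F 1 x
      + x * (x^2 - 4 * N + 2) * F 0 x = 0" for x
    unfolding F_def f0_def f1_def f2_def f3_def f5_def comb_def
    by (simp add: eval_nat_numeral) (simp add: field_simps)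
  moreover have "deriv f = F 1"
    using deriv[of 1] by simp
  moreover have "(deriv ^^ k) f differentiable (at x)" if "k < 5" for k x
    unfolding real_differentiable_def using F[OF that] deriv[of k] that by auto
  ultimately show ?thesis
    using deriv[of 5] deriv[of 3] deriv[of 2] deriv[of 0] by simp
qed

section \<open>Identification of the eigenvalue density\<close>

text \<open>The expected counts determine the integral from x - 1, and a continuous density is the
  derivative of that integral.\<close>

lemma is_goe_eigenvalue_density_unique:
  assumes "is_goe_eigenvalue_density N f" "is_goe_eigenvalue_density N g"
  shows "f = g"
proof
  fix x
  have deriv: "((\<lambda>y. integral {x - 1..y} h) has_real_derivative h x) (at x)"
    if "is_goe_eigenvalue_density N h" for h
  proof -
    have "continuous_on {x - 1..x + 1} h"
      using that continuous_on_subset unfolding is_goe_eigenvalue_density_def by blast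
    then have "((\<lambda>y. integral {x - 1..y} h) has_real_derivative h x) (at x within {x - 1..x + 1})"
      by (rule integral_has_real_derivative) auto
    then show ?thesis by (subst (asm) at_within_interior) auto
  qed
  have "integral {x - 1..y} f = integral {x - 1..y} g" for y
    using assms unfolding is_goe_eigenvalue_density_def
    by (cases "x - 1 \<le> y") (metis integral_unique, simp)
  then show "f x = g x"
    using DERIV_unique[OF deriv[OF assms(1)]] deriv[OF assms(2)] by simp
qed

lemma goe_weight_eq: "goe_weight N l = (\<Prod>j\<in>{..<N}. gauss (l j)) * vdm {..<N} l"
proof -
  have "(\<Prod>j<k. \<bar>l k - l j\<bar>) = (\<Prod>j\<in>{j \<in> {..<N}. j < k}. \<bar>l k - l j\<bar>)" if "k < N" for k
    using that by (intro prod.cong) auto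
  then show ?thesis
    unfolding goe_weight_def vdm_def gauss_def by simp
qed

lemma continuous_on_goe_density_core: "continuous_on A (goe_density_core n)"
proof -
  have "continuous_on A (eps k)" for k
    using DERIV_eps by (meson DERIV_continuous continuous_at_imp_continuous_on)
  then show ?thesis
    unfolding goe_density_core_def[abs_def] by (intro continuous_intros continuous_on_psi)
qed

text \<open>Contribution of the j-th eigenvalue to the count: with \<open>l j\<close> as outer
  variable, the inner integral is the one-point weight. Its explicit form makes it continuous, so
  its Lebesgue integral over [a, b] is also a gauge integral.\<close>

lemma integral_goe_weight_coord:
  assumes "j < N" "a \<le> b"
  shows "((\<lambda>x. gauss x * goe_int ({..<N} - {j}) (\<lambda>l. \<Prod>i\<in>{..<N} - {j}. \<bar>l i - x\<bar>)) has_integral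
     (\<integral>l. indicator {a..b} (l j) * goe_weight N l \<partial>lborel_PiM {..<N})) {a..b}"
    and "integrable (lborel_PiM {..<N}) (\<lambda>l. indicator {a..b} (l j) * goe_weight N l)"
proof -
  have "j \<in> {..<N}" using assms by simp
  define I where "I = {..<N} - {j}"
  have I: "finite I" "j \<notin> I" "{..<N} = insert j I" using assms by (auto simp: I_def)
  define s where "s x = gauss x * goe_int I (\<lambda>l. \<Prod>i\<in>I. \<bar>l i - x\<bar>)" for x
  have pg: "poly_growth {..<N} (\<lambda>l. vdm {..<N} l * indicator {a..b} (l j))"
  proof (intro poly_growth_mult poly_growth_vdm)
    have "(\<lambda>l. l j) \<in> borel_measurable (lborel_PiM {..<N})"
      using \<open>j \<in> {..<N}\<close> by measurable
    then have "(\<lambda>l. indicator {a..b} (l j) :: real) \<in> borel_measurable (lborel_PiM {..<N})"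
      by measurable
    then show "poly_growth {..<N} (\<lambda>l. indicator {a..b} (l j))"
      by (rule poly_growth_dominated[OF poly_growth_const[of _ 1]]) (simp add: indicator_def)
  qed auto
  have eq: "(\<lambda>l. indicator {a..b} (l j) * goe_weight N l)
      = (\<lambda>l. (\<Prod>j\<in>{..<N}. gauss (l j)) * (vdm {..<N} l * indicator {a..b} (l j)))"
    by (simp add: goe_weight_eq fun_eq_iff)
  show int: "integrable (lborel_PiM {..<N}) (\<lambda>l. indicator {a..b} (l j) * goe_weight N l)"
    unfolding eq by (intro poly_growth_integrable pg) auto
  have "(\<integral>l. indicator {a..b} (l j) * goe_weight N l \<partial>lborel_PiM {..<N})
      = (\<integral>x. \<integral>l. indicator {a..b} ((l(j := x)) j) * goe_weight N (l(j := x)) \<partial>lborel_PiM I \<partial>lborel)"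
    by (rule lborel_PiM.product_integral_insert_rev[OF I(1,2), folded I(3), OF int])
  also have "\<dots> = (LINT x:{a..b}|lborel. s x)"
    unfolding set_lebesgue_integral_def
  proof (rule Bochner_Integration.integral_cong[OF refl])
    fix x
    have "goe_weight N (l(j := x)) = gauss x * ((\<Prod>i\<in>I. gauss (l i)) * (vdm I l * (\<Prod>i\<in>I. \<bar>l i - x\<bar>)))" for l
    proof -
      have g: "(\<Prod>i\<in>I. gauss ((l(j := x)) i)) = (\<Prod>i\<in>I. gauss (l i))"
        using I(2) by (intro prod.cong) auto
      have p: "(\<Prod>i\<in>I. \<bar>(l(j := x)) i - (l(j := x)) j\<bar>) = (\<Prod>i\<in>I. \<bar>l i - x\<bar>)"
        using I(2) by (intro prod.cong) auto
      show ?thesis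
        unfolding goe_weight_eq I(3) prod.insert[OF I(1,2)] vdm_insert[OF I(1,2)] vdm_fun_upd[OF I(2)] g p
        by (simp only: fun_upd_same mult.assoc)
    qed
    then show "(\<integral>l. indicator {a..b} ((l(j := x)) j) * goe_weight N (l(j := x)) \<partial>lborel_PiM I)
        = indicator {a..b} x *\<^sub>R s x"
      by (simp add: s_def goe_int_def)
  qed
  finally have count: "(\<integral>l. indicator {a..b} (l j) * goe_weight N l \<partial>lborel_PiM {..<N}) = (LINT x:{a..b}|lborel. s x)" .
  obtain c d where "\<forall>x. s x = c * goe_density_core (card I) x + d * psi (card I) x"
    using goe_one_point_weight[OF I(1)] unfolding s_def by (elim exE)
  then have "continuous_on {a..b} s"
    by (auto intro!: continuous_intros continuous_on_goe_density_core continuous_on_psi)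
  note set_borel_integral_eq_integral[OF borel_integrable_atLeastAtMost'[OF this]]
  then show "((\<lambda>x. gauss x * goe_int ({..<N} - {j}) (\<lambda>l. \<Prod>i\<in>{..<N} - {j}. \<bar>l i - x\<bar>)) has_integral
     (\<integral>l. indicator {a..b} (l j) * goe_weight N l \<partial>lborel_PiM {..<N})) {a..b}"
    unfolding count I_def[symmetric] s_def[symmetric, abs_def] by (simp add: integrable_integral)
qed

text \<open>Linearity of expectation: the count is a sum of indicators, one for each
  eigenvalue.\<close>

lemma is_goe_eigenvalue_density_one_point:
  "is_goe_eigenvalue_density N (\<lambda>x. \<Sum>j<N. gauss x
     * goe_int ({..<N} - {j}) (\<lambda>l. \<Prod>i\<in>{..<N} - {j}. \<bar>l i - x\<bar>) / goe_partition N)"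
  (is "is_goe_eigenvalue_density N (\<lambda>x. \<Sum>j<N. ?s j x / _)")
  unfolding is_goe_eigenvalue_density_def
proof (intro conjI allI impI)
  have "continuous_on UNIV (?s j)" for j
  proof -
    have "finite ({..<N} - {j})" by simp
    from goe_one_point_weight[OF this] obtain c d
      where "\<forall>x. ?s j x = c * goe_density_core (card ({..<N} - {j})) x + d * psi (card ({..<N} - {j})) x"
      by (elim exE)
    then show ?thesis
      by (auto intro!: continuous_intros continuous_on_goe_density_core continuous_on_psi)
  qed
  then show "continuous_on UNIV (\<lambda>x. \<Sum>j<N. ?s j x / goe_partition N)"
    unfolding divide_inverse by (intro continuous_on_sum continuous_on_mult_right)
  fix a b :: real
  assume "a \<le> b"
  note coord = integral_goe_weight_coord[OF _ this]
  have weight_nonneg: "0 \<le> goe_weight N l" for l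
    unfolding goe_weight_eq by (intro mult_nonneg_nonneg prod_nonneg vdm_nonneg) (simp add: gauss_pos less_imp_le)
  then have nonneg: "0 \<le> goe_weight N l / goe_partition N" for l
    unfolding goe_partition_def by simp
  have count: "real (card {j. j < N \<and> l j \<in> {a..b}}) = (\<Sum>j<N. indicator {a..b} (l j))" for l :: "nat \<Rightarrow> real"
  proof -
    have "{j. j < N \<and> l j \<in> {a..b}} = {j \<in> {..<N}. l j \<in> {a..b}}" by auto
    then show ?thesis
      by (simp add: indicator_def sum.If_cases Int_def)
  qed
  have meas: "goe_weight N \<in> borel_measurable (lborel_PiM {..<N})"
    unfolding goe_weight_eq[abs_def]
    using poly_growth_integrable[OF _ poly_growth_vdm, of "{..<N}" "{..<N}"] by auto
  have "goe_expected_count N a b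
      = (\<integral>l. (goe_weight N l / goe_partition N) *\<^sub>R (\<Sum>j<N. indicator {a..b} (l j)) \<partial>lborel_PiM {..<N})"
    unfolding goe_expected_count_def goe_law_def count
    by (rule integral_density) (use meas nonneg in \<open>auto intro!: borel_measurable_sum\<close>)
  also have "\<dots> = (\<integral>l. (\<Sum>j<N. indicator {a..b} (l j) * goe_weight N l / goe_partition N) \<partial>lborel_PiM {..<N})"
    by (simp add: sum_distrib_left mult_ac sum_divide_distrib)
  also have "\<dots> = (\<Sum>j<N. (\<integral>l. indicator {a..b} (l j) * goe_weight N l \<partial>lborel_PiM {..<N}) / goe_partition N)"
    using coord(2) by (subst Bochner_Integration.integral_sum) auto
  finally have eq: "goe_expected_count N a b
      = (\<Sum>j<N. (\<integral>l. indicator {a..b} (l j) * goe_weight N l \<partial>lborel_PiM {..<N}) / goe_partition N)" .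
  show "((\<lambda>x. \<Sum>j<N. ?s j x / goe_partition N) has_integral goe_expected_count N a b) {a..b}"
    unfolding eq by (intro has_integral_sum has_integral_divide coord) auto
qed

theorem mainTheorem6:
  fixes N :: nat and \<rho> :: "real \<Rightarrow> real"
  assumes "N \<ge> 1"
  defines "\<rho> \<equiv> goe_eigenvalue_density N"
  shows "(\<forall>k<5. \<forall>x. (deriv ^^ k) \<rho> differentiable (at x)) \<and>
    (\<forall>x. - 4 * (deriv ^^ 5) \<rho> x
         + 5 * (x^2 - 4 * real N + 2) * (deriv ^^ 3) \<rho> x
         - 6 * x * (deriv ^^ 2) \<rho> x
         + (- (x^4) + (8 * real N - 4) * x^2 - 16 * (real N)^2 + 16 * real N + 2) * deriv \<rho> x
         + x * (x^2 - 4 * real N + 2) * \<rho> x = 0)"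
proof -
  obtain n where N: "N = Suc n" using assms(1) by (cases N) auto
  \<comment> \<open>Removing any one eigenvalue leaves n = N - 1 points, so all N contributions
    involve the same two functions.\<close>
  have "\<exists>c d. \<forall>x. gauss x * goe_int ({..<N} - {j}) (\<lambda>l. \<Prod>i\<in>{..<N} - {j}. \<bar>l i - x\<bar>)
      = c * goe_density_core n x + d * psi n x" if "j < N" for j
  proof -
    have "card ({..<N} - {j}) = n" using that N by simp
    then show ?thesis using goe_one_point_weight[of "{..<N} - {j}"] by simp
  qed
  then obtain c d where cd: "\<And>j x. j < N \<Longrightarrow> gauss x * goe_int ({..<N} - {j}) (\<lambda>l. \<Prod>i\<in>{..<N} - {j}. \<bar>l i - x\<bar>)
      = c j * goe_density_core n x + d j * psi n x"
    by metis
  define C where "C = (\<Sum>j<N. c j / goe_partition N)"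
  define D where "D = (\<Sum>j<N. d j / goe_partition N)"
  have "goe_eigenvalue_density N = (\<lambda>x. \<Sum>j<N. gauss x
     * goe_int ({..<N} - {j}) (\<lambda>l. \<Prod>i\<in>{..<N} - {j}. \<bar>l i - x\<bar>) / goe_partition N)"
    unfolding goe_eigenvalue_density_def
    by (rule the_equality) (auto intro: is_goe_eigenvalue_density_one_point is_goe_eigenvalue_density_unique)
  then have "\<rho> x = (\<Sum>j<N. (c j * goe_density_core n x + d j * psi n x) / goe_partition N)" for x
    unfolding \<rho>_def by (simp add: cd)
  then have \<rho>: "\<rho> x = C * goe_density_core n x + D * psi n x" for x
    unfolding C_def D_def by (simp add: add_divide_distrib sum.distrib sum_distrib_right)
  show ?thesis
  \<comment> \<open>The term D psi_n enters \<open>E\<close> as the constant -D, which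
    differentiation removes.\<close>
  proof (rule goe_density_ode[where u = "psi n" and v = "psi N" and c = C and E = "\<lambda>x. C * eps N x - D"])
    fix x
    have "(real n * psi (n - 1) x - psi (Suc n) x) / 2 = x * psi n x / 2 - psi N x"
      using psi_Suc[of n x] by (simp add: N field_simps)
    then show "(psi n has_real_derivative x * psi n x / 2 - psi N x) (at x)"
      using DERIV_psi[of n x] by (simp only:)
    have "(real N * psi (N - 1) x - psi (Suc N) x) / 2 = real N * psi n x - x * psi N x / 2"
      using psi_Suc[of N x] by (simp add: N field_simps)
    then show "(psi N has_real_derivative real N * psi n x - x * psi N x / 2) (at x)"
      using DERIV_psi[of N x] by (simp only:)
    show "((\<lambda>x. C * eps N x - D) has_real_derivative - 2 * C * psi N x) (at x)"
      by (auto intro!: derivative_eq_intros DERIV_eps)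
    show "\<rho> x = C * (4 * (real N * (psi n x)\<^sup>2 - x * psi n x * psi N x + (psi N x)\<^sup>2)) - psi n x * (C * eps N x - D)"
      by (simp add: \<rho> goe_density_core_def N algebra_simps)
  qed
qed

end
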